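(* Let $X$ be a Peano continuum with a compatible metric $d$, and suppose $H_1(X)$ has cardinality $< 2^{\aleph_0}$. Then there exist $\epsilon>0$ and $N\in\omega$ such that every loop $l$ in $X$ of diameter less than $\epsilon$ has commutator length at most $N$, where the commutator length is computed for $[l]$ in the group $\pi_1(X, l(0))$.
   Context: A Peano continuum is a path connected, locally path connected, compact metrizable space. For a group $G$ and $g\in G$, the commutator length $\mathrm{cl}(g)$ is the smallest $n$ such that $g$ is a product of $n$ commutators, and $\mathrm{cl}(g)=\infty$ if $g\notin[G,G]$. The diameter of a loop is the diameter of its image. *)

theory Defs
  imports "HOL-Analysis.Analysis" "HOL-Homology.Homology" "HOL-Library.Equipollence"
          "HOL-Library.Extended_Nat"
begin

definition loops_at :: "'a::topological_space set \<Rightarrow> 'a \<Rightarrow> (real \<Rightarrow> 'a) set" where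
  "loops_at S x = {p. path p \<and> path_image p \<subseteq> S \<and> pathstart p = x \<and> pathfinish p = x}"

definition loop_class :: "'a::topological_space set \<Rightarrow> 'a \<Rightarrow> (real \<Rightarrow> 'a) \<Rightarrow> (real \<Rightarrow> 'a) set" where
  "loop_class S x p = {q \<in> loops_at S x. homotopic_paths S p q}"

definition fundamental_group :: "'a::topological_space set \<Rightarrow> 'a \<Rightarrow> (real \<Rightarrow> 'a) set monoid" where
  "fundamental_group S x =
     \<lparr> carrier = loop_class S x ` loops_at S x,
       mult = (\<lambda>A B. loop_class S x ((SOME p. p \<in> A) +++ (SOME q. q \<in> B))),
       one = loop_class S x (\<lambda>t. x) \<rparr>"

definition group_commutator :: "('a, 'b) monoid_scheme \<Rightarrow> 'a \<Rightarrow> 'a \<Rightarrow> 'a" where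
  "group_commutator G a b = a \<otimes>\<^bsub>G\<^esub> b \<otimes>\<^bsub>G\<^esub> inv\<^bsub>G\<^esub> a \<otimes>\<^bsub>G\<^esub> inv\<^bsub>G\<^esub> b"

definition prod_commutators :: "('a, 'b) monoid_scheme \<Rightarrow> ('a \<times> 'a) list \<Rightarrow> 'a" where
  "prod_commutators G xs = foldr (\<lambda>(a, b) acc. group_commutator G a b \<otimes>\<^bsub>G\<^esub> acc) xs \<one>\<^bsub>G\<^esub>"

definition is_prod_of_commutators :: "('a, 'b) monoid_scheme \<Rightarrow> nat \<Rightarrow> 'a \<Rightarrow> bool" where
  "is_prod_of_commutators G n g \<longleftrightarrow>
     (\<exists>xs. length xs = n \<and> set xs \<subseteq> carrier G \<times> carrier G \<and> g = prod_commutators G xs)"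

definition commutator_length :: "('a, 'b) monoid_scheme \<Rightarrow> 'a \<Rightarrow> enat" where
  "commutator_length G g =
     (if \<exists>n. is_prod_of_commutators G n g then enat (LEAST n. is_prod_of_commutators G n g) else \<infinity>)"

end

theory Submission
  imports Defs
begin

text \<open>If there were arbitrarily small loops of large commutator length, then compactness and local path
  connectedness would give loops \<open>c n\<close> at one point, shrinking to it, such that \<open>c n\<close> is not a product of
  at most \<open>n\<close> commutators. For \<open>\<alpha> :: nat \<Rightarrow> bool\<close> let \<open>L \<alpha>\<close> be the infinite concatenation of those \<open>c n\<close>
  with \<open>\<alpha> n\<close>. The set \<open>E k\<close> of pairs \<open>(\<alpha>, \<beta>)\<close> for which \<open>[L \<alpha>] [L \<beta>]\<inverse>\<close> is a product of \<open>k\<close> commutators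
  arises from closed sets by Suslin's operation, so it has the Baire property. If it were nonmeager, it would
  be comeager in some basic open set, hence contain \<open>(\<alpha>, \<beta>)\<close> and \<open>(\<alpha>, \<beta>')\<close> with \<open>\<beta>\<close> and \<open>\<beta>'\<close> differing at a
  single large \<open>n\<close>, and then \<open>c n\<close>, being conjugate to \<open>([L \<beta>] [L \<beta>']\<inverse>)\<^sup>\<plusminus>\<^sup>1\<close>, would be a product of \<open>2 k\<close>
  commutators. So all \<open>E k\<close> are meager, and Mycielski's theorem yields continuum many \<open>\<alpha>\<close> whose loops are
  pairwise distinct in the abelianised fundamental group, hence in the first homology group.\<close>

section \<open>Meager sets and Suslin's operation\<close>

text \<open>Being a product of \<open>k\<close> commutators is an existential statement about loops
  and a homotopy. For pointwise convergence all equations between them are closed conditions, but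
  continuity is not, so a projection along the witnesses need not be closed. A prescribed modulus of
  continuity, coded by a sequence of natural numbers, makes the set of admissible witnesses compact
  by Tychonoff's theorem; letting the code vary is exactly Suslin's operation. In this way product
  topologies suffice throughout. The relation is split according to \<open>k\<close> because only a
  bound on the number of commutators can contradict the choice of \<open>c n\<close>: two pairs with
  a common member combine to \<open>2 k\<close>, and the flipped place \<open>n\<close> can be taken
  at least that large. The hypothesis bounds the homology group by the continuum and not by a
  countable cardinal, so uncountably many inequivalent loops would not be enough; Mycielski's
  theorem gives continuum many without any assumption on cardinals.\<close>

instance bool :: second_countable_topology
proof
  show "\<exists>B::bool set set. countable B \<and> open = generate_topology B"
  proof (intro exI conjI)
    show "countable (UNIV :: bool set set)"
      by (simp add: countable_finite)
    show "open = generate_topology (UNIV :: bool set set)"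
      by (auto simp: fun_eq_iff open_discrete intro: generate_topology.Basis)
  qed
qed

definition meager :: "'a::topological_space set \<Rightarrow> bool" where
  "meager A \<longleftrightarrow> (\<exists>F::nat \<Rightarrow> 'a set. (\<forall>n. closed (F n) \<and> interior (F n) = {}) \<and> A \<subseteq> (\<Union>n. F n))"

lemma meager_subset: "meager B \<Longrightarrow> A \<subseteq> B \<Longrightarrow> meager A"
  unfolding meager_def by (meson subset_trans)

lemma meager_nowhere_dense: "closed A \<Longrightarrow> interior A = {} \<Longrightarrow> meager A"
  unfolding meager_def by (intro exI[of _ "\<lambda>_. A"]) simp

lemma meager_UN_nat:
  fixes A :: "nat \<Rightarrow> 'a::topological_space set"
  assumes "\<And>n. meager (A n)"
  shows "meager (\<Union>n. A n)"
proof -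
  have "\<forall>n. \<exists>F::nat \<Rightarrow> 'a set. (\<forall>k. closed (F k) \<and> interior (F k) = {}) \<and> A n \<subseteq> (\<Union>k. F k)"
    using assms by (simp add: meager_def)
  from choice[OF this] obtain F :: "nat \<Rightarrow> nat \<Rightarrow> 'a set" where
      "\<forall>n. (\<forall>k. closed (F n k) \<and> interior (F n k) = {}) \<and> A n \<subseteq> (\<Union>k. F n k)" ..
  then have F: "\<And>n k. closed (F n k)" "\<And>n k. interior (F n k) = {}"
      "\<And>n. A n \<subseteq> (\<Union>k. F n k)"
    by auto
  have "(\<Union>n. A n) \<subseteq> (\<Union>m. case_prod F (prod_decode m))"
  proof clarify
    fix x n assume "x \<in> A n"
    then obtain k where "x \<in> F n k" using F(3) by blast
    then have "x \<in> case_prod F (prod_decode (prod_encode (n, k)))" by simp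
    then show "x \<in> (\<Union>m. case_prod F (prod_decode m))" by (rule UN_I[OF UNIV_I])
  qed
  then show ?thesis
    unfolding meager_def using F(1,2)
    by (intro exI[of _ "\<lambda>m. case_prod F (prod_decode m)"]) (auto split: prod.split)
qed

lemma meager_UN:
  assumes "countable I" "\<And>i. i \<in> I \<Longrightarrow> meager (A i)"
  shows "meager (\<Union>i\<in>I. A i)"
proof (cases "I = {}")
  case True
  then show ?thesis by (simp add: meager_nowhere_dense)
next
  case False
  have "meager (\<Union>n. A (from_nat_into I n))"
    using assms(2) False by (intro meager_UN_nat) (simp add: from_nat_into)
  moreover have "(\<Union>i\<in>I. A i) = (\<Union>n. A (from_nat_into I n))"
    using False assms(1) by (metis (no_types) image_image range_from_nat_into)
  ultimately show ?thesis by simp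
qed

lemma meager_Un: "meager A \<Longrightarrow> meager B \<Longrightarrow> meager (A \<union> B)"
  using meager_UN[of "{A, B}" id] by (auto simp: Un_commute)

lemma meager_frontier: "closed A \<Longrightarrow> meager (A - interior A)"
proof (rule meager_nowhere_dense)
  show "interior (A - interior A) = {}"
    using interior_mono[of "A - interior A" A] interior_subset[of "A - interior A"] by blast
qed auto

text \<open>The points at which \<open>A\<close> is of second category, classically written D(A). Up
  to a meager set it is a closed hull of \<open>A\<close>.\<close>

definition nonmeager_points :: "'a::topological_space set \<Rightarrow> 'a set" where
  "nonmeager_points A = {x. \<forall>U. open U \<longrightarrow> x \<in> U \<longrightarrow> \<not> meager (A \<inter> U)}"

lemma closed_nonmeager_points: "closed (nonmeager_points A)"
proof -
  have "- nonmeager_points A = \<Union>{U. open U \<and> meager (A \<inter> U)}"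
    by (auto simp: nonmeager_points_def)
  then show ?thesis
    by (simp add: closed_def open_Union)
qed

lemma nonmeager_points_subset:
  assumes "closed F" "A \<subseteq> F" shows "nonmeager_points A \<subseteq> F"
proof -
  have "A \<inter> (- F) = {}" using assms by auto
  then show ?thesis
    using assms(1) unfolding nonmeager_points_def
    by (metis (mono_tags, lifting) ComplI closed_def closed_empty interior_empty mem_Collect_eq
        meager_nowhere_dense subsetI)
qed

text \<open>Countably many basic open sets with meager trace cover the difference. The instance for
  \<open>bool\<close> supplies the countable basis in the case of the Cantor space.\<close>

lemma meager_diff_nonmeager_points:
  fixes A :: "'a::second_countable_topology set"
  shows "meager (A - nonmeager_points A)"
proof -
  obtain B :: "'a set set" where B: "countable B" "topological_basis B"
    using ex_countable_basis by blast
  let ?I = "{U \<in> B. meager (A \<inter> U)}"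
  have "meager (\<Union>U\<in>?I. A \<inter> U)"
    using B(1) by (intro meager_UN) auto
  moreover have "A - nonmeager_points A \<subseteq> (\<Union>U\<in>?I. A \<inter> U)"
  proof
    fix x assume x: "x \<in> A - nonmeager_points A"
    then obtain U where "open U" "x \<in> U" "meager (A \<inter> U)"
      by (auto simp: nonmeager_points_def)
    moreover then obtain V where "V \<in> B" "x \<in> V" "V \<subseteq> U"
      using B(2) by (meson topological_basisE)
    ultimately show "x \<in> (\<Union>U\<in>?I. A \<inter> U)"
      using x meager_subset[of "A \<inter> U" "A \<inter> V"] by blast
  qed
  ultimately show ?thesis by (rule meager_subset)
qed

text \<open>An open \<open>V\<close> inside D of the union has a nonmeager trace
  \<open>A i \<inter> V\<close> for some \<open>i\<close>. If \<open>V\<close> also missed the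
  interior of D(\<open>A i\<close>), that trace would lie in the meager set made of
  \<open>A i\<close> outside D(\<open>A i\<close>) and the frontier of D(\<open>A i\<close>).
  Removing interiors instead of the sets D(\<open>A i\<close>) leaves a closed set, which is
  therefore nowhere dense.\<close>

lemma meager_nonmeager_points_diff_UN:
  fixes A :: "nat \<Rightarrow> 'a::second_countable_topology set"
  shows "meager (nonmeager_points (\<Union>i. A i) - (\<Union>i. nonmeager_points (A i)))"
proof -
  let ?D = nonmeager_points
  let ?O = "\<Union>i. interior (?D (A i))"
  have "interior (?D (\<Union>i. A i) - ?O) = {}"
  proof (rule ccontr)
    assume "interior (?D (\<Union>i. A i) - ?O) \<noteq> {}"
    then obtain V x where V: "open V" "x \<in> V" "V \<subseteq> ?D (\<Union>i. A i) - ?O"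
      by (meson all_not_in_conv open_interior interior_subset)
    then have "\<not> meager ((\<Union>i. A i) \<inter> V)"
      by (auto simp: nonmeager_points_def)
    then obtain i where i: "\<not> meager (A i \<inter> V)"
      using meager_UN_nat[of "\<lambda>i. A i \<inter> V"] by auto
    have "A i \<inter> V \<subseteq> (A i - ?D (A i)) \<union> (?D (A i) - interior (?D (A i)))"
      using V(3) by auto
    moreover have "meager ((A i - ?D (A i)) \<union> (?D (A i) - interior (?D (A i))))"
      by (intro meager_Un meager_diff_nonmeager_points meager_frontier closed_nonmeager_points)
    ultimately show False
      using i meager_subset by blast
  qed
  then have "meager (?D (\<Union>i. A i) - ?O)"
    by (intro meager_nowhere_dense closed_Diff closed_nonmeager_points) auto
  then show ?thesis
    by (rule meager_subset) (use interior_subset in blast)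
qed

text \<open>The part of Nikodym's theorem, that Suslin's operation preserves the Baire property, which says
  that a nonmeager result is comeager in some open set. Outside a meager set, every point around which the
  piece at \<open>s\<close> is nonmeager is also such a point for the piece at some \<open>s @ [i]\<close>, and this yields a branch.\<close>

lemma Suslin_nonmeager_imp_comeager:
  fixes F :: "nat list \<Rightarrow> 'a::second_countable_topology set"
  assumes F: "\<And>s. closed (F s)"
    and A: "A = {x. \<exists>m::nat \<Rightarrow> nat. \<forall>n. x \<in> F (map m [0..<n])}"
    and nonmeager: "\<not> meager A"
  obtains U where "open U" "U \<noteq> {}" "meager (U - A)"
proof -
  \<comment> \<open>The part of \<open>A\<close> whose branches pass through \<open>s\<close>. All
    prefixes of the branch are demanded, the short ones included, so that \<open>S s\<close> lies in
    \<open>F s\<close>.\<close>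
  define S where "S s = {x. \<exists>m::nat \<Rightarrow> nat. (\<forall>i<length s. m i = s ! i) \<and>
    (\<forall>n. x \<in> F (map m [0..<n]))}" for s
  define D where "D s = nonmeager_points (S s)" for s
  \<comment> \<open>The points where the search for a branch gets stuck: around them the piece at
    \<open>s\<close> is nonmeager, but no piece at a successor of \<open>s\<close> is. There are
    only countably many \<open>s\<close>.\<close>
  define M where "M = (\<Union>s. D s - (\<Union>i. D (s @ [i])))"
  have S_nil: "S [] = A" by (simp add: S_def A)
  have S_UN: "S s = (\<Union>i. S (s @ [i]))" for s
  proof (intro subset_antisym subsetI)
    fix x assume "x \<in> S s"
    then obtain m where "\<forall>i<length s. m i = s ! i" "\<forall>n. x \<in> F (map m [0..<n])"
      by (auto simp: S_def)
    then have "x \<in> S (s @ [m (length s)])"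
      by (auto simp: S_def nth_append less_Suc_eq intro!: exI[of _ m])
    then show "x \<in> (\<Union>i. S (s @ [i]))" by blast
  next
    fix x assume "x \<in> (\<Union>i. S (s @ [i]))"
    then obtain i m where m: "\<forall>j<Suc (length s). m j = (s @ [i]) ! j" "\<forall>n. x \<in> F (map m [0..<n])"
      by (auto simp: S_def)
    have "m j = s ! j" if "j < length s" for j
      using m(1) that by (metis less_SucI nth_append)
    with m(2) show "x \<in> S s"
      unfolding S_def by blast
  qed
  have "S s \<subseteq> F s" for s
  proof
    fix x assume "x \<in> S s"
    then obtain m where m: "\<forall>i<length s. m i = s ! i" "\<forall>n. x \<in> F (map m [0..<n])"
      by (auto simp: S_def)
    have "map m [0..<length s] = s"
      using m(1) by (intro nth_equalityI) auto
    with m(2) show "x \<in> F s" by metis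
  qed
  then have D_F: "D s \<subseteq> F s" for s
    unfolding D_def using F nonmeager_points_subset by blast
  have "meager M"
    unfolding M_def
  proof (rule meager_UN)
    show "meager (D s - (\<Union>i. D (s @ [i])))" for s
      unfolding D_def by (subst S_UN) (rule meager_nonmeager_points_diff_UN)
  qed auto
  moreover have "D [] - A \<subseteq> M"
  proof (rule ccontr)
    assume "\<not> D [] - A \<subseteq> M"
    then obtain x where x: "x \<in> D []" "x \<notin> A" "x \<notin> M" by blast
    have "\<exists>t. \<forall>n. (length (t n) = n \<and> x \<in> D (t n)) \<and> (\<exists>i. t (Suc n) = t n @ [i])"
    proof (rule dependent_nat_choice)
      show "\<exists>t. length t = 0 \<and> x \<in> D t" using x(1) by simp
      fix s :: "nat list" and n
      assume "length s = n \<and> x \<in> D s"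
      then show "\<exists>t. (length t = Suc n \<and> x \<in> D t) \<and> (\<exists>i. t = s @ [i])"
        using x(3) unfolding M_def by force
    qed
    then obtain t where t: "\<And>n. length (t n) = n" "\<And>n. x \<in> D (t n)"
        "\<And>n. \<exists>i. t (Suc n) = t n @ [i]" by blast
    define m where "m n = t (Suc n) ! n" for n
    have "map m [0..<n] = t n" for n
    proof (induction n)
      case (Suc n)
      obtain i where "t (Suc n) = t n @ [i]" using t(3) by blast
      then show ?case using Suc t(1)[of n] by (simp add: m_def nth_append)
    qed (use t(1)[of 0] in simp)
    then have "x \<in> F (map m [0..<n])" for n
      using t(2) D_F by auto
    then have "x \<in> A" by (auto simp: A)
    with x show False by simp
  qed
  ultimately have DA: "meager (D [] - A)" by (rule meager_subset)
  have D_closed: "closed (D [])" by (simp add: D_def closed_nonmeager_points)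
  \<comment> \<open>Otherwise \<open>A\<close> would be covered by its meager part outside
    \<open>D []\<close> together with the nowhere dense set \<open>D []\<close>.\<close>
  have "interior (D []) \<noteq> {}"
  proof
    assume "interior (D []) = {}"
    then have "meager ((A - D []) \<union> D [])"
      using meager_diff_nonmeager_points[of A] D_closed S_nil
      by (intro meager_Un) (simp_all add: D_def meager_nowhere_dense)
    then show False
      using nonmeager meager_subset by blast
  qed
  moreover have "meager (interior (D []) - A)"
    using DA by (rule meager_subset) (use interior_subset in blast)
  ultimately show thesis using that by blast
qed

section \<open>Baire category, compact function spaces and moduli of continuity\<close>

lemma Baire_meager:
  fixes U :: "'a::topological_space set"
  assumes "compact (UNIV :: 'a set)" "Hausdorff_space (euclidean :: 'a topology)" "open U" "meager U"
  shows "U = {}"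
proof -
  obtain F :: "nat \<Rightarrow> 'a set" where F: "\<And>n. closed (F n)" "\<And>n. interior (F n) = {}"
      "U \<subseteq> (\<Union>n. F n)"
    using assms(4) unfolding meager_def by blast
  have "compact_space (euclidean :: 'a topology)"
    using assms(1) by (simp add: compact_space_def)
  then have "locally_compact_space (euclidean :: 'a topology)"
      "regular_space (euclidean :: 'a topology)"
    using assms(2) compact_imp_locally_compact_space compact_Hausdorff_imp_regular_space by blast+
  then have "euclidean interior_of \<Union>(range F) = {}"
    by (rule Baire_category_aux) (use F in \<open>auto simp: closed_closedin[symmetric]\<close>)
  then have "interior (\<Union>(range F)) = {}"
    by simp
  then show ?thesis
    using F(3) assms(3) interior_maximal by blast
qed

lemma meager_homeomorphic_image:
  assumes "meager A" "continuous_on UNIV f" "continuous_on UNIV g" "\<And>x. f (g x) = x" "\<And>x. g (f x) = x"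
  shows "meager (f ` A)"
proof -
  obtain F :: "nat \<Rightarrow> 'a set" where F: "\<And>n. closed (F n)" "\<And>n. interior (F n) = {}"
      "A \<subseteq> (\<Union>n. F n)"
    using assms(1) unfolding meager_def by blast
  have eq: "f ` B = g -` B" for B
  proof (intro subset_antisym subsetI)
    fix y assume "y \<in> g -` B"
    then show "y \<in> f ` B" using assms(4)[of y] by (metis image_eqI vimageD)
  qed (use assms(5) in auto)
  have "closed (f ` F n)" for n
    unfolding eq using F(1) assms(3) by (simp add: closed_vimage)
  moreover have "interior (f ` F n) = {}" for n
  proof -
    have "open (f -` interior (f ` F n))"
      using assms(2) by (simp add: open_vimage)
    moreover have "f -` interior (f ` F n) \<subseteq> F n"
      using interior_subset[of "f ` F n"] unfolding eq using assms(5) by auto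
    ultimately have "f -` interior (f ` F n) = {}"
      using F(2) interior_maximal by blast
    then show ?thesis using assms(4) by blast
  qed
  moreover have "f ` A \<subseteq> (\<Union>n. f ` F n)"
    using image_mono[OF F(3), of f] by (simp only: image_UN)
  ultimately show ?thesis
    unfolding meager_def by (intro exI[of _ "\<lambda>n. f ` F n"] conjI allI)
qed

text \<open>Tychonoff's theorem. It serves the Cantor space and also, with an uncountable index
  type, the witnesses defined on a square.\<close>

lemma compact_fun_UNIV:
  fixes X :: "'a::topological_space set"
  assumes "compact X"
  shows "compact {f :: 'i \<Rightarrow> 'a. \<forall>i. f i \<in> X}"
proof -
  have "compactin (product_topology (\<lambda>_::'i. euclidean :: 'a topology) UNIV) (PiE UNIV (\<lambda>_. X))"
    using assms by (simp add: compactin_PiE)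
  moreover have "PiE UNIV (\<lambda>_::'i. X) = {f. \<forall>i. f i \<in> X}"
    by auto
  ultimately show ?thesis
    by (simp add: euclidean_product_topology)
qed

text \<open>One sequence of natural numbers codes moduli for all \<open>w i\<close> together. Level
  \<open>k\<close> constrains only the finitely many \<open>i \<le> k\<close>, so a single number
  \<open>m k\<close> can serve them; continuity of \<open>w i\<close> is read off from the levels
  \<open>k \<ge> i\<close>. The inequalities are not strict, which makes each constraint closed for
  pointwise convergence.\<close>

lemma continuous_on_iff_modulus_sequence:
  fixes w :: "nat \<Rightarrow> 'k::metric_space \<Rightarrow> 'a::metric_space"
  assumes "compact K"
  shows "(\<forall>i. continuous_on K (w i)) \<longleftrightarrow>
    (\<exists>m::nat \<Rightarrow> nat. \<forall>k. \<forall>i\<le>k. \<forall>x\<in>K. \<forall>y\<in>K.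
       dist x y \<le> 1 / (real (m k) + 1) \<longrightarrow> dist (w i x) (w i y) \<le> 1 / (real k + 1))"
    (is "?L \<longleftrightarrow> (\<exists>m. \<forall>k. \<forall>i\<le>k. ?P i k (m k))")
proof
  assume ?L
  have "\<exists>m. \<forall>i\<le>k. ?P i k m" for k
  proof -
    have "eventually (?P i k) sequentially" for i
    proof -
      have "uniformly_continuous_on K (w i)"
        using \<open>?L\<close> assms by (simp add: compact_uniformly_continuous)
      then obtain d where "d > 0" and d: "\<And>x y. x \<in> K \<Longrightarrow> y \<in> K \<Longrightarrow> dist x y < d \<Longrightarrow>
          dist (w i x) (w i y) < 1 / (real k + 1)"
        unfolding uniformly_continuous_on_def
        by (metis divide_pos_pos of_nat_0_le_iff zero_less_one add_nonneg_pos dist_commute)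
      have "eventually (\<lambda>m::nat. 1 / (real m + 1) < d) sequentially"
        using \<open>d > 0\<close> by real_asymp
      then show ?thesis
        by (rule eventually_mono) (use d in \<open>force intro: less_imp_le\<close>)
    qed
    then have "eventually (\<lambda>m. \<forall>i\<in>{..k}. ?P i k m) sequentially"
      by (intro eventually_ball_finite) auto
    then obtain m where "\<forall>i\<in>{..k}. ?P i k m"
      using eventually_happens trivial_limit_sequentially by blast
    then show ?thesis by auto
  qed
  then show "\<exists>m. \<forall>k. \<forall>i\<le>k. ?P i k (m k)"
    by (intro choice allI)
next
  assume "\<exists>m. \<forall>k. \<forall>i\<le>k. ?P i k (m k)"
  then obtain m where m: "\<And>k i. i \<le> k \<Longrightarrow> ?P i k (m k)" by blast
  show ?L
    unfolding continuous_on_iff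
  proof (intro allI ballI impI)
    fix i x and e :: real assume "x \<in> K" "e > 0"
    have "eventually (\<lambda>k::nat. 1 / (real k + 1) < e) sequentially"
      using \<open>e > 0\<close> by real_asymp
    then have "eventually (\<lambda>k. 1 / (real k + 1) < e \<and> i \<le> k) sequentially"
      using eventually_ge_at_top eventually_conj by blast
    then obtain k where k: "1 / (real k + 1) < e" "i \<le> k"
      by (metis (mono_tags, lifting) eventually_happens trivial_limit_sequentially)
    show "\<exists>d>0. \<forall>x'\<in>K. dist x' x < d \<longrightarrow> dist (w i x') (w i x) < e"
      using m[OF k(2)] k(1) \<open>x \<in> K\<close>
      by (intro exI[of _ "1 / (real (m k) + 1)"]) (force)
  qed
qed

lemma compact_Cantor_pairs: "compact (UNIV :: ((nat \<Rightarrow> bool) \<times> (nat \<Rightarrow> bool)) set)"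
proof -
  have "compact (UNIV :: (nat \<Rightarrow> bool) set)"
    using compact_fun_UNIV[of "UNIV :: bool set"] by (simp add: finite_imp_compact)
  from compact_Times[OF this this] show ?thesis by simp
qed

lemma Hausdorff_Cantor_pairs: "Hausdorff_space (euclidean :: ((nat \<Rightarrow> bool) \<times> (nat \<Rightarrow> bool)) topology)"
proof -
  have "Hausdorff_space (euclidean :: bool topology)"
    unfolding Hausdorff_space_def disjnt_def by (metis open_openin separation_t2)
  then have "Hausdorff_space (product_topology (\<lambda>_::nat. euclidean :: bool topology) UNIV)"
    by (simp add: Hausdorff_space_product_topology)
  then have "Hausdorff_space (euclidean :: (nat \<Rightarrow> bool) topology)"
    by (simp add: euclidean_product_topology)
  then have "Hausdorff_space (prod_topology (euclidean :: (nat \<Rightarrow> bool) topology) (euclidean :: (nat \<Rightarrow> bool) topology))"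
    unfolding Hausdorff_space_prod_topology by blast
  then show ?thesis by simp
qed

text \<open>A projection of a closed set along continuous witnesses comes from Suslin's operation: once
  a modulus of continuity is prescribed, the witnesses form a compact set.\<close>

lemma continuous_witness_Suslin:
  fixes C :: "('z::topological_space \<times> (nat \<Rightarrow> 'k::metric_space \<Rightarrow> 'a::metric_space)) set"
  assumes Z: "compact (UNIV :: 'z set)" "Hausdorff_space (euclidean :: 'z topology)" and C: "closed C" and X: "compact X" and K: "compact K"
  shows "\<exists>F. (\<forall>s::nat list. closed (F s)) \<and>
    {z. \<exists>w. (\<forall>i x. w i x \<in> X) \<and> (\<forall>i. continuous_on K (w i)) \<and> (z, w) \<in> C}
      = {z. \<exists>m. \<forall>n. z \<in> F (map m [0..<n])}"
proof -
  define P where "P = {w :: nat \<Rightarrow> 'k \<Rightarrow> 'a. \<forall>i. w i \<in> {f. \<forall>x. f x \<in> X}}"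
  define md where "md c k = (\<Inter>i\<in>{..k}. \<Inter>(x, y)\<in>{(x, y). x \<in> K \<and> y \<in> K \<and> dist x y \<le> 1 / (real c + 1)}.
     {w :: nat \<Rightarrow> 'k \<Rightarrow> 'a. dist (w i x) (w i y) \<le> 1 / (real k + 1)})" for c k
  define T where "T s = (\<Inter>k\<in>{..<length s}. md (s ! k) k)" for s
  \<comment> \<open>A projection of a compact set, since \<open>P\<close> and the parameter space
    are compact while \<open>C\<close> and \<open>T s\<close> are closed; hence closed in the
    Hausdorff space of parameters.\<close>
  define F where "F s = fst ` (UNIV \<times> P \<inter> (C \<inter> UNIV \<times> T s))" for s
  have P: "compact P"
    unfolding P_def by (intro compact_fun_UNIV X)
  have ev: "continuous_on UNIV (\<lambda>w :: nat \<Rightarrow> 'k \<Rightarrow> 'a. w i x)" for i x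
    by (rule continuous_on_product_then_coordinatewise[OF continuous_on_product_coordinates])
  have "closed (md c k)" for c k
    unfolding md_def
    by (intro closed_INT ballI, clarify, rule closed_Collect_le)
      (intro continuous_on_dist ev continuous_on_const)+
  then have T: "closed (T s)" for s
    unfolding T_def by (intro closed_INT ballI)
  have "closed (F s)" for s
  proof -
    have "compact (F s)"
      unfolding F_def
      by (intro compact_continuous_image continuous_on_fst continuous_on_id
          compact_Int_closed compact_Times Z(1) P closed_Int C closed_Times closed_UNIV T)
    then show ?thesis
      using compactin_imp_closedin[OF Z(2), of "F s"] by simp
  qed
  moreover have "(\<exists>w. (\<forall>i x. w i x \<in> X) \<and> (\<forall>i. continuous_on K (w i)) \<and> (z, w) \<in> C)
      \<longleftrightarrow> (\<exists>m. \<forall>n. z \<in> F (map m [0..<n]))" for z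
  proof
    assume "\<exists>w. (\<forall>i x. w i x \<in> X) \<and> (\<forall>i. continuous_on K (w i)) \<and> (z, w) \<in> C"
    then obtain w m where "\<forall>i x. w i x \<in> X" "(z, w) \<in> C" "\<forall>k. w \<in> md (m k) k"
      unfolding continuous_on_iff_modulus_sequence[OF K] md_def by blast
    then have "z \<in> F (map m [0..<n])" for n
      by (auto simp: F_def P_def T_def intro!: image_eqI[of _ _ "(z, w)"])
    then show "\<exists>m. \<forall>n. z \<in> F (map m [0..<n])" by blast
  next
    assume "\<exists>m. \<forall>n. z \<in> F (map m [0..<n])"
    then obtain m where m: "\<And>n. z \<in> F (map m [0..<n])" by blast
    \<comment> \<open>Each prefix of \<open>m\<close> comes with its own witness. The constraints
      \<open>V n\<close> shrink as \<open>n\<close> grows, so compactness of \<open>P\<close> yields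
      one witness for all of them.\<close>
    define V where "V n = (Pair z -` C) \<inter> T (map m [0..<n])" for n
    have "P \<inter> \<Inter>(range V) \<noteq> {}"
    proof (rule compact_imp_fip[OF P])
      show "closed B" if "B \<in> range V" for B
      proof -
        have "closed (Pair z -` C)"
          by (intro closed_vimage C continuous_intros)
        then show ?thesis using that T unfolding V_def by auto
      qed
      fix \<F> assume "finite \<F>" "\<F> \<subseteq> range V"
      then obtain N where N: "finite N" "\<F> = V ` N"
        by (meson finite_subset_image)
      obtain n where n: "\<forall>k\<in>N. k \<le> n"
        using N(1) by (metis finite_nat_set_iff_bounded_le)
      obtain w where "w \<in> P" "(z, w) \<in> C" "w \<in> T (map m [0..<n])"
        using m[of n] by (auto simp: F_def)
      moreover then have "w \<in> V k" if "k \<in> N" for k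
        using n that by (force simp: V_def T_def)
      ultimately show "P \<inter> \<Inter>\<F> \<noteq> {}"
        using N(2) by blast
    qed
    then obtain w where "w \<in> P" "\<And>n. w \<in> V n" by blast
    \<comment> \<open>The constraint with index \<open>k\<close> first occurs in the prefix of
      length \<open>Suc k\<close>.\<close>
    moreover then have "(z, w) \<in> C" "w \<in> md (m k) k" for k
      by (auto simp: V_def T_def dest: spec[of _ "Suc k"])
    ultimately show "\<exists>w. (\<forall>i x. w i x \<in> X) \<and> (\<forall>i. continuous_on K (w i)) \<and> (z, w) \<in> C"
      unfolding continuous_on_iff_modulus_sequence[OF K]
      by (intro exI[of _ w] conjI exI[of _ m]) (auto simp: P_def md_def)
  qed
  ultimately show ?thesis by (intro exI[of _ F]) auto
qed

section \<open>Mycielski's theorem for the Cantor space\<close>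

definition agree_on :: "nat set \<Rightarrow> (nat \<Rightarrow> bool) \<Rightarrow> (nat \<Rightarrow> bool) \<Rightarrow> bool" where
  "agree_on I x y \<longleftrightarrow> (\<forall>i\<in>I. x i = y i)"

lemma open_cylinder: "open {y. agree_on {..<n} y x}"
  using product_topology_basis'[of "{..<n}" "\<lambda>i. {x i}" id]
  by (simp add: agree_on_def open_discrete)

lemma open_contains_cylinder:
  assumes "open S" "x \<in> S"
  shows "\<exists>n. \<forall>m\<ge>n. \<forall>y. agree_on {..<m} y x \<longrightarrow> y \<in> S"
proof -
  have "openin (product_topology (\<lambda>_. euclidean) UNIV) S"
    using assms(1) by (simp add: euclidean_product_topology)
  then obtain B where B: "x \<in> PiE UNIV B" "finite {i. B i \<noteq> UNIV}" "PiE UNIV B \<subseteq> S"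
    using product_topology_open_contains_basis[of "\<lambda>_. euclidean" UNIV S x] assms(2) by auto
  then obtain n where n: "\<forall>i\<in>{i. B i \<noteq> UNIV}. i < n"
    by (metis finite_nat_set_iff_bounded)
  have "y \<in> S" if "agree_on {..<m} y x" "n \<le> m" for m y
  proof -
    have "y i \<in> B i" for i
    proof (cases "i < n")
      case True
      then show ?thesis using that B(1) by (auto simp: agree_on_def PiE_iff)
    qed (use n in auto)
    then show ?thesis using B(3) by auto
  qed
  then show ?thesis by blast
qed

context
  fixes U :: "((nat \<Rightarrow> bool) \<times> (nat \<Rightarrow> bool)) set"
  assumes U: "open U" and dense: "closure U = UNIV"
begin

lemma dense_extend_prefixes:
  "\<exists>u' v' n'. n \<le> n' \<and> agree_on {..<n} u' u \<and> agree_on {..<n} v' v \<and>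
     (\<forall>x y. agree_on {..<n'} x u' \<and> agree_on {..<n'} y v' \<longrightarrow> (x, y) \<in> U)"
proof -
  let ?C = "{x. agree_on {..<n} x u} \<times> {x. agree_on {..<n} x v}"
  have "open ?C" by (intro open_Times open_cylinder)
  moreover have "(u, v) \<in> ?C" by (simp add: agree_on_def)
  ultimately have "?C \<inter> U \<noteq> {}"
    using dense open_Int_closure_eq_empty[of ?C U] by blast
  then obtain u' v' where uv: "(u', v') \<in> ?C" "(u', v') \<in> U" by auto
  then obtain A B where AB: "open A" "open B" "u' \<in> A" "v' \<in> B" "A \<times> B \<subseteq> U"
    using U open_prod_elim[of U "(u', v')"] by (metis mem_Sigma_iff)
  obtain n1 where n1: "\<forall>m\<ge>n1. \<forall>y. agree_on {..<m} y u' \<longrightarrow> y \<in> A"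
    using open_contains_cylinder[OF AB(1,3)] by blast
  obtain n2 where n2: "\<forall>m\<ge>n2. \<forall>y. agree_on {..<m} y v' \<longrightarrow> y \<in> B"
    using open_contains_cylinder[OF AB(2,4)] by blast
  define n' where "n' = max n (max n1 n2)"
  have "n \<le> n'" "n1 \<le> n'" "n2 \<le> n'" by (auto simp: n'_def)
  then have "(x, y) \<in> U" if "agree_on {..<n'} x u'" "agree_on {..<n'} y v'" for x y
    using n1 n2 AB(5) that by blast
  then show ?thesis
    using uv(1) \<open>n \<le> n'\<close> by blast
qed

text \<open>The pairs are served one after another by lengthening the common block. A pair already
  served stays in \<open>U\<close>, because its condition speaks of all sequences that follow the
  shorter block.\<close>

lemma dense_extend_finite_prefixes:
  assumes "finite P"
  shows "\<exists>a b n'. n \<le> n' \<and> (\<forall>(u, v)\<in>P. \<forall>x y. agree_on {..<n} x u \<and> agree_on {n..<n'} x a \<and>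
     agree_on {..<n} y v \<and> agree_on {n..<n'} y b \<longrightarrow> (x, y) \<in> U)"
  using assms
proof (induction P)
  case (insert p P)
  obtain u v where p: "p = (u, v)" by fastforce
  obtain a b n' where IH: "n \<le> n'" "\<And>u v x y. (u, v) \<in> P \<Longrightarrow> agree_on {..<n} x u \<Longrightarrow>
      agree_on {n..<n'} x a \<Longrightarrow> agree_on {..<n} y v \<Longrightarrow> agree_on {n..<n'} y b \<Longrightarrow> (x, y) \<in> U"
    using insert.IH by fast
  let ?u = "\<lambda>i. if i < n then u i else a i" and ?v = "\<lambda>i. if i < n then v i else b i"
  obtain u' v' n'' where new: "n' \<le> n''" "agree_on {..<n'} u' ?u" "agree_on {..<n'} v' ?v"
      "\<And>x y. agree_on {..<n''} x u' \<Longrightarrow> agree_on {..<n''} y v' \<Longrightarrow> (x, y) \<in> U"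
    using dense_extend_prefixes[of n' ?u ?v] by blast
  have "(x, y) \<in> U" if "(s, t) \<in> insert p P" "agree_on {..<n} x s" "agree_on {n..<n''} x u'"
    "agree_on {..<n} y t" "agree_on {n..<n''} y v'" for s t x y
  proof (cases "(s, t) \<in> P")
    case True
    moreover have "agree_on {n..<n'} x a" "agree_on {n..<n'} y b"
      using that new(1-3) by (auto simp: agree_on_def)
    ultimately show ?thesis using IH(2) that by blast
  next
    case False
    then have st: "s = u" "t = v" using that p by auto
    have "agree_on {..<n''} x u'" "agree_on {..<n''} y v'"
      using that new(1-3) IH(1) unfolding st agree_on_def
      by (metis atLeastLessThan_iff lessThan_iff linorder_not_less order_less_le_trans)+
    then show ?thesis using new(4) by blast
  qed
  then show ?case
    using IH(1) new(1) by (intro exI[of _ u'] exI[of _ v'] exI[of _ n'']) auto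
qed auto

text \<open>There are finitely many pairs of prefixes of length \<open>n\<close>, and
  \<open>Q\<close> represents each prefix by a sequence that is false from \<open>n\<close> on.
  Serving all of them with one block makes membership in \<open>U\<close> independent of what
  precedes the block, so the blocks can be fixed before it is known how the earlier ones are
  filled.\<close>

lemma dense_block:
  "\<exists>n' a b. n \<le> n' \<and> (\<forall>x y. agree_on {n..<n'} x a \<and> agree_on {n..<n'} y b \<longrightarrow> (x, y) \<in> U)"
proof -
  define Q where "Q = (\<lambda>A i. i \<in> A) ` Pow {..<n}"
  have "finite (Q \<times> Q)" by (simp add: Q_def)
  from dense_extend_finite_prefixes[OF this, of n] obtain a b n' where n': "n \<le> n'"
      "\<And>u v x y. u \<in> Q \<Longrightarrow> v \<in> Q \<Longrightarrow> agree_on {..<n} x u \<Longrightarrow>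
      agree_on {n..<n'} x a \<Longrightarrow> agree_on {..<n} y v \<Longrightarrow> agree_on {n..<n'} y b \<Longrightarrow> (x, y) \<in> U"
    by fast
  have "\<exists>u\<in>Q. agree_on {..<n} x u" for x
    unfolding Q_def by (rule bexI[OF _ imageI[of "{i. i < n \<and> x i}"]]) (auto simp: agree_on_def)
  then show ?thesis using n' by meson
qed

end

text \<open>Mycielski's theorem for the Cantor space. Each block of \<open>g x\<close> copies one of two patterns
  according to one bit of \<open>x\<close>, and every bit of \<open>x\<close> is consulted infinitely often.\<close>

lemma Mycielski:
  fixes E :: "((nat \<Rightarrow> bool) \<times> (nat \<Rightarrow> bool)) set"
  assumes "meager E" and sym: "\<And>x y. (x, y) \<in> E \<Longrightarrow> (y, x) \<in> E"
  shows "\<exists>g :: (nat \<Rightarrow> bool) \<Rightarrow> nat \<Rightarrow> bool. \<forall>x y. x \<noteq> y \<longrightarrow> (g x, g y) \<notin> E"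
proof -
  obtain F :: "nat \<Rightarrow> ((nat \<Rightarrow> bool) \<times> (nat \<Rightarrow> bool)) set" where
    F: "\<And>n. closed (F n)" "\<And>n. interior (F n) = {}" "E \<subseteq> (\<Union>n. F n)"
    using assms(1) unfolding meager_def by blast
  \<comment> \<open>Decreasing open dense sets: entering \<open>U k\<close> for some
    \<open>k \<ge> n\<close> is enough to avoid \<open>F n\<close>.\<close>
  define U where "U n = - (\<Union>k\<le>n. F k)" for n
  have "interior (\<Union>k\<le>n. F k) = {}" for n :: nat
  proof (induction n)
    case (Suc n)
    have "closed (\<Union>k\<le>n. F k)" using F(1) by auto
    then have "interior ((\<Union>k\<le>n. F k) \<union> F (Suc n)) = {}"
      using Suc F(2)[of "Suc n"] by (simp add: interior_closed_Un_empty_interior)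
    then show ?case by (simp add: atMost_Suc Un_commute)
  qed (simp add: F(2))
  then have "closure (U n) = UNIV" "open (U n)" for n
    unfolding U_def closure_complement using F(1) by (simp, intro open_Compl closed_UN) auto
  then have "\<forall>n l. \<exists>l' a b. l \<le> l' \<and>
      (\<forall>x y. agree_on {l..<l'} x a \<and> agree_on {l..<l'} y b \<longrightarrow> (x, y) \<in> U n)"
    using dense_block by blast
  then obtain next_l a b where step: "\<And>n l. l \<le> next_l n l"
      "\<And>n l x y. agree_on {l..<next_l n l} x (a n l) \<Longrightarrow> agree_on {l..<next_l n l} y (b n l) \<Longrightarrow> (x, y) \<in> U n"
    by metis
  define l where "l = rec_nat 0 next_l"
  have l_Suc: "l (Suc n) = next_l n (l n)" for n by (simp add: l_def)
  have mono: "mono l" by (rule mono_iff_le_Suc[THEN iffD2]) (simp add: l_Suc step(1))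
  \<comment> \<open>The number of a block codes a pair whose first component is the bit consulted
    there; bit \<open>m\<close> is thus consulted in the blocks \<open>prod_encode (m, n)\<close>
    for all \<open>n\<close>.\<close>
  define g where "g x i = (let n = LEAST n. i < l (Suc n) in
    if x (fst (prod_decode n)) then a n (l n) i else b n (l n) i)" for x i
  have g: "g x i = (if x (fst (prod_decode n)) then a n (l n) i else b n (l n) i)"
    if "l n \<le> i" "i < l (Suc n)" for x i n
  proof -
    have "(LEAST n. i < l (Suc n)) = n"
    proof (intro Least_equality)
      fix k assume "i < l (Suc k)"
      with that(1) have "\<not> l (Suc k) \<le> l n" by simp
      then show "n \<le> k" using monoD[OF mono, of "Suc k" n] by linarith
    qed fact
    then show ?thesis by (simp add: g_def)
  qed
  have *: "(g x, g y) \<notin> E" if "x m" "\<not> y m" for x y m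
  proof
    assume "(g x, g y) \<in> E"
    then obtain n where n: "(g x, g y) \<in> F n" using F(3) by blast
    \<comment> \<open>A block that consults the bit \<open>m\<close> separating \<open>x\<close>
      from \<open>y\<close> and whose number is at least \<open>n\<close>.\<close>
    define k where "k = prod_encode (m, n)"
    have "(g x, g y) \<in> U k"
    proof (rule step(2))
      show "agree_on {l k..<next_l k (l k)} (g x) (a k (l k))"
        using that g unfolding l_Suc[symmetric] by (auto simp: agree_on_def k_def)
      show "agree_on {l k..<next_l k (l k)} (g y) (b k (l k))"
        using that g unfolding l_Suc[symmetric] by (auto simp: agree_on_def k_def)
    qed
    moreover have "n \<le> k" by (simp add: k_def le_prod_encode_2)
    ultimately show False using n by (auto simp: U_def)
  qed
  \<comment> \<open>If the separating bit is false in \<open>x\<close> and true in \<open>y\<close>,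
    the symmetry of \<open>E\<close> exchanges the two.\<close>
  have "(g x, g y) \<notin> E" if "x \<noteq> y" for x y
    using that * sym by blast
  then show ?thesis by blast
qed

section \<open>Commutators and the fundamental group\<close>

context group
begin

lemma group_commutator_closed [simp]:
  "a \<in> carrier G \<Longrightarrow> b \<in> carrier G \<Longrightarrow> group_commutator G a b \<in> carrier G"
  by (simp add: group_commutator_def)

lemma inv_group_commutator:
  "a \<in> carrier G \<Longrightarrow> b \<in> carrier G \<Longrightarrow> inv (group_commutator G a b) = group_commutator G b a"
  by (simp add: group_commutator_def inv_mult_group m_assoc)

lemma prod_commutators_Nil: "prod_commutators G [] = \<one>"
  by (simp add: prod_commutators_def)

lemma prod_commutators_Cons:
  "prod_commutators G ((a, b) # xs) = group_commutator G a b \<otimes> prod_commutators G xs"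
  by (simp add: prod_commutators_def)

lemma prod_commutators_closed [simp]:
  "set xs \<subseteq> carrier G \<times> carrier G \<Longrightarrow> prod_commutators G xs \<in> carrier G"
  by (induction xs) (auto simp: prod_commutators_Nil prod_commutators_Cons)

lemma prod_commutators_append:
  "set xs \<subseteq> carrier G \<times> carrier G \<Longrightarrow> set ys \<subseteq> carrier G \<times> carrier G \<Longrightarrow>
    prod_commutators G (xs @ ys) = prod_commutators G xs \<otimes> prod_commutators G ys"
  by (induction xs) (auto simp: prod_commutators_Nil prod_commutators_Cons m_assoc)

lemma is_prod_of_commutators_one: "is_prod_of_commutators G 0 \<one>"
  by (simp add: is_prod_of_commutators_def prod_commutators_Nil)

lemma is_prod_of_commutators_commutator:
  "a \<in> carrier G \<Longrightarrow> b \<in> carrier G \<Longrightarrow> is_prod_of_commutators G 1 (group_commutator G a b)"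
  unfolding is_prod_of_commutators_def
  by (intro exI[of _ "[(a, b)]"]) (simp add: prod_commutators_Nil prod_commutators_Cons)

lemma is_prod_of_commutators_mult:
  assumes "is_prod_of_commutators G m g" "is_prod_of_commutators G n h"
  shows "is_prod_of_commutators G (m + n) (g \<otimes> h)"
proof -
  obtain xs ys where "length xs = m" "set xs \<subseteq> carrier G \<times> carrier G" "g = prod_commutators G xs"
    "length ys = n" "set ys \<subseteq> carrier G \<times> carrier G" "h = prod_commutators G ys"
    using assms by (auto simp: is_prod_of_commutators_def)
  then show ?thesis
    unfolding is_prod_of_commutators_def
    by (intro exI[of _ "xs @ ys"]) (simp add: prod_commutators_append)
qed

text \<open>The inverse of the commutator of \<open>a\<close> and \<open>b\<close> is that of
  \<open>b\<close> and \<open>a\<close>; inverting a product reverses the factors and keeps their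
  number.\<close>

lemma is_prod_of_commutators_inv:
  assumes "is_prod_of_commutators G n g"
  shows "is_prod_of_commutators G n (inv g)"
proof -
  have "is_prod_of_commutators G (length xs) (inv (prod_commutators G xs))"
    if "set xs \<subseteq> carrier G \<times> carrier G" for xs
    using that
  proof (induction xs)
    case Nil
    then show ?case by (simp add: prod_commutators_Nil is_prod_of_commutators_one)
  next
    case (Cons ab xs)
    obtain a b where ab: "ab = (a, b)" "a \<in> carrier G" "b \<in> carrier G" using Cons.prems by auto
    have "inv (prod_commutators G (ab # xs)) = inv (prod_commutators G xs) \<otimes> group_commutator G b a"
      using Cons.prems ab by (simp add: prod_commutators_Cons inv_mult_group inv_group_commutator)
    then show ?case
      using is_prod_of_commutators_mult[OF Cons.IH is_prod_of_commutators_commutator[OF ab(3,2)]]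
        Cons.prems by simp
  qed
  then show ?thesis
    using assms by (auto simp: is_prod_of_commutators_def)
qed

lemma derived_imp_is_prod_of_commutators:
  assumes "g \<in> derived G (carrier G)"
  shows "\<exists>n. is_prod_of_commutators G n g"
  using assms unfolding derived_def
proof (induction rule: generate.induct)
  case (incl h)
  then show ?case
    using is_prod_of_commutators_commutator by (auto simp: group_commutator_def)
next
  case (inv h)
  then show ?case
    using is_prod_of_commutators_inv is_prod_of_commutators_commutator
    by (fastforce simp: group_commutator_def)
qed (use is_prod_of_commutators_one is_prod_of_commutators_mult in blast)+

end

lemma hom_is_prod_of_commutators:
  assumes "group G" "group H" "f \<in> hom G H" "is_prod_of_commutators G n g"
  shows "is_prod_of_commutators H n (f g)"
proof -
  interpret group_hom G H f
    using assms(1-3) by (simp add: group_hom_def group_hom_axioms_def)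
  have "f (prod_commutators G xs) = prod_commutators H (map (map_prod f f) xs)"
    if "set xs \<subseteq> carrier G \<times> carrier G" for xs
    using that
    by (induction xs)
      (auto simp: G.prod_commutators_Nil H.prod_commutators_Nil G.prod_commutators_Cons
        H.prod_commutators_Cons group_commutator_def)
  moreover have "set (map (map_prod f f) xs) \<subseteq> carrier H \<times> carrier H"
    if "set xs \<subseteq> carrier G \<times> carrier G" for xs
    using that by auto
  ultimately show ?thesis
    using assms(4) unfolding is_prod_of_commutators_def by (metis length_map)
qed

text \<open>Conjugation by \<open>inv x\<close> is an endomorphism, and homomorphisms preserve the
  number of commutators.\<close>

lemma (in group) is_prod_of_commutators_conj:
  assumes "x \<in> carrier G" "g \<in> carrier G" "is_prod_of_commutators G n (x \<otimes> g \<otimes> inv x)"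
  shows "is_prod_of_commutators G n g"
proof -
  have cancel: "x \<otimes> (inv x \<otimes> z) = z" if "z \<in> carrier G" for z
    using assms(1) that by (simp flip: m_assoc)
  have "(\<lambda>h. inv x \<otimes> h \<otimes> x) \<in> hom G G"
    using assms(1) by (intro homI) (simp_all add: m_assoc cancel)
  from hom_is_prod_of_commutators[OF is_group is_group this assms(3)]
  have "is_prod_of_commutators G n (inv x \<otimes> (x \<otimes> g))"
    using assms(1,2) by (simp add: m_assoc)
  moreover have "inv x \<otimes> (x \<otimes> g) = g"
    using assms(1,2) by (simp flip: m_assoc)
  ultimately show ?thesis by simp
qed

lemma commutator_length_le: "is_prod_of_commutators G n g \<Longrightarrow> commutator_length G g \<le> enat n"
  by (auto simp: commutator_length_def intro: Least_le)

section \<open>Paths and their homotopies in an arbitrary topological space\<close>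

definition path_in :: "'a::topological_space set \<Rightarrow> (real \<Rightarrow> 'a) \<Rightarrow> bool" where
  "path_in S p \<longleftrightarrow> path p \<and> path_image p \<subseteq> S"

lemma path_in_join [simp]:
  "path_in S p \<Longrightarrow> path_in S q \<Longrightarrow> pathfinish p = pathstart q \<Longrightarrow> path_in S (p +++ q)"
  by (simp add: path_in_def subset_path_image_join)

lemma path_in_reversepath [simp]: "path_in S (reversepath p) \<longleftrightarrow> path_in S p"
  by (simp add: path_in_def)

lemma path_in_const [simp]: "path_in S (\<lambda>_. x) \<longleftrightarrow> x \<in> S"
  by (auto simp: path_in_def path_def path_image_def)

lemma homotopic_paths_path_in: "homotopic_paths S p q \<Longrightarrow> path_in S p \<and> path_in S q"
  by (simp add: path_in_def homotopic_paths_imp_path homotopic_paths_imp_subset)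

lemma homotopic_paths_refl' [simp]: "homotopic_paths S p p \<longleftrightarrow> path_in S p"
  by (simp add: path_in_def)

declare homotopic_paths_refl [simp del]

text \<open>The library states several of the following facts only for normed spaces, because it writes
  constant paths as linepaths. They all follow from the convexity of the parameter interval.\<close>

lemma homotopic_paths_compose:
  fixes \<phi> \<psi> :: "real \<Rightarrow> 'b::real_normed_vector"
  assumes p: "continuous_on T p" "p ` T \<subseteq> S" and T: "convex T"
    and "path_in T \<phi>" "path_in T \<psi>"
    and "pathstart \<phi> = pathstart \<psi>" "pathfinish \<phi> = pathfinish \<psi>"
  shows "homotopic_paths S (p \<circ> \<phi>) (p \<circ> \<psi>)"
proof -
  have "closed_segment (\<phi> t) (\<psi> t) \<subseteq> T" if "t \<in> {0..1}" for t
    using assms(4,5) that T by (intro closed_segment_subset) (auto simp: path_in_def path_image_def)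
  then have "homotopic_paths T \<phi> \<psi>"
    using assms by (intro homotopic_paths_linear) (auto simp: path_in_def)
  then show ?thesis
    by (rule homotopic_paths_continuous_image) (use p in auto)
qed

lemma homotopic_paths_compose_01:
  fixes \<phi> \<psi> :: "real \<Rightarrow> real"
  assumes "path_in S p" "path_in {0..1} \<phi>" "path_in {0..1} \<psi>"
    and "pathstart \<phi> = pathstart \<psi>" "pathfinish \<phi> = pathfinish \<psi>"
  shows "homotopic_paths S (p \<circ> \<phi>) (p \<circ> \<psi>)"
  by (rule homotopic_paths_compose[of "{0..1}"])
    (use assms in \<open>auto simp: path_in_def path_def path_image_def\<close>)

lemma path_in_id: "path_in {0..1} (\<lambda>t::real. t)"
  by (simp add: path_in_def path_def path_image_def)

lemma homotopic_paths_const_left: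
  assumes "path_in S p"
  shows "homotopic_paths S ((\<lambda>_. pathstart p) +++ p) p"
proof -
  \<comment> \<open>Both sides are reparametrisations of \<open>p\<close>, and two parameter paths
    in the unit interval with the same ends are homotopic there. The next two lemmas use the same
    device.\<close>
  have "homotopic_paths S (p \<circ> ((\<lambda>_. 0) +++ (\<lambda>t. t))) (p \<circ> (\<lambda>t. t))"
    using assms path_in_id
    by (intro homotopic_paths_compose_01 path_in_join) (auto simp: pathstart_def pathfinish_def joinpaths_def)
  then show ?thesis
    unfolding path_compose_join by (simp add: comp_def pathstart_def)
qed

lemma homotopic_paths_const_right:
  assumes "path_in S p"
  shows "homotopic_paths S (p +++ (\<lambda>_. pathfinish p)) p"
proof -
  have "homotopic_paths S (p \<circ> ((\<lambda>t. t) +++ (\<lambda>_. 1))) (p \<circ> (\<lambda>t. t))"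
    using assms path_in_id
    by (intro homotopic_paths_compose_01 path_in_join) (auto simp: pathstart_def pathfinish_def joinpaths_def)
  then show ?thesis
    unfolding path_compose_join by (simp add: comp_def pathfinish_def)
qed

lemma homotopic_paths_reverse_right:
  assumes "path_in S p"
  shows "homotopic_paths S (p +++ reversepath p) (\<lambda>_. pathstart p)"
proof -
  have "homotopic_paths S (p \<circ> ((\<lambda>t. t) +++ reversepath (\<lambda>t. t))) (p \<circ> (\<lambda>_. 0))"
    using assms path_in_id
    by (intro homotopic_paths_compose_01 path_in_join)
      (simp_all, simp_all add: pathstart_def pathfinish_def)
  then show ?thesis
    unfolding path_compose_join path_compose_reversepath by (simp add: comp_def pathstart_def)
qed

lemma homotopic_paths_reverse_left:
  assumes "path_in S p"
  shows "homotopic_paths S (reversepath p +++ p) (\<lambda>_. pathfinish p)"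
  using homotopic_paths_reverse_right[of S "reversepath p"] assms by simp

lemma homotopic_paths_assoc':
  assumes "path_in S p" "path_in S q" "path_in S r" "pathfinish p = pathstart q" "pathfinish q = pathstart r"
  shows "homotopic_paths S ((p +++ q) +++ r) (p +++ (q +++ r))"
  using homotopic_paths_assoc[of p S q r] assms homotopic_paths_sym by (auto simp: path_in_def)

lemma homotopic_paths_join_left:
  "homotopic_paths S p p' \<Longrightarrow> path_in S q \<Longrightarrow> pathfinish p = pathstart q \<Longrightarrow>
    homotopic_paths S (p +++ q) (p' +++ q)"
  by (simp add: homotopic_paths_join)

lemma homotopic_paths_join_right:
  "homotopic_paths S q q' \<Longrightarrow> path_in S p \<Longrightarrow> pathfinish p = pathstart q \<Longrightarrow>
    homotopic_paths S (p +++ q) (p +++ q')"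
  by (simp add: homotopic_paths_join)

lemma homotopic_paths_cancel_left:
  assumes "path_in S p" "path_in S q" "pathfinish p = pathstart q"
  shows "homotopic_paths S (reversepath p +++ (p +++ q)) q"
proof -
  have "homotopic_paths S (reversepath p +++ (p +++ q)) ((reversepath p +++ p) +++ q)"
    using assms by (intro homotopic_paths_sym[OF homotopic_paths_assoc']) auto
  also have "homotopic_paths S \<dots> ((\<lambda>_. pathstart q) +++ q)"
    using assms homotopic_paths_reverse_left[of S p] by (intro homotopic_paths_join_left) auto
  also have "homotopic_paths S \<dots> q"
    using assms by (simp add: homotopic_paths_const_left)
  finally show ?thesis .
qed

text \<open>Two connecting paths are allowed, since in \<open>homologous_loops_derived\<close> they
  lead from the base point to the two ends of \<open>p\<close>. A change of base point takes
  \<open>a = b\<close>.\<close>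

definition conj_path :: "(real \<Rightarrow> 'a::topological_space) \<Rightarrow> (real \<Rightarrow> 'a) \<Rightarrow> (real \<Rightarrow> 'a) \<Rightarrow> real \<Rightarrow> 'a" where
  "conj_path a p b = a +++ (p +++ reversepath b)"

lemma pathstart_conj_path [simp]: "pathstart (conj_path a p b) = pathstart a"
  by (simp add: conj_path_def)

lemma pathfinish_conj_path [simp]: "pathfinish (conj_path a p b) = pathstart b"
  by (simp add: conj_path_def)

lemma path_in_conj_path [simp]:
  "path_in S a \<Longrightarrow> path_in S p \<Longrightarrow> path_in S b \<Longrightarrow> pathfinish a = pathstart p \<Longrightarrow>
    pathfinish p = pathfinish b \<Longrightarrow> path_in S (conj_path a p b)"
  by (simp add: conj_path_def)

lemma homotopic_paths_conj_path:
  "homotopic_paths S p p' \<Longrightarrow> path_in S a \<Longrightarrow> path_in S b \<Longrightarrow> pathfinish a = pathstart p \<Longrightarrow>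
    pathfinish p = pathfinish b \<Longrightarrow> homotopic_paths S (conj_path a p b) (conj_path a p' b)"
  unfolding conj_path_def
  by (intro homotopic_paths_join_right homotopic_paths_join_left) auto

text \<open>The inner detour, back along \<open>b\<close> and out again, cancels. This makes
  conjugation multiplicative, both for a change of base point and for the map on chains.\<close>

lemma homotopic_paths_conj_path_join:
  assumes "path_in S a" "path_in S p" "path_in S b" "path_in S q" "path_in S c"
    "pathfinish a = pathstart p" "pathfinish p = pathfinish b" "pathfinish b = pathstart q"
    "pathfinish q = pathfinish c" "pathstart b = x"
  shows "homotopic_paths S (conj_path a p b +++ conj_path b q c) (conj_path a (p +++ q) c)"
proof -
  let ?qc = "q +++ reversepath c"
  have "homotopic_paths S (conj_path a p b +++ conj_path b q c)
      (a +++ ((p +++ reversepath b) +++ (b +++ ?qc)))"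
    unfolding conj_path_def using assms by (intro homotopic_paths_assoc') auto
  also have "homotopic_paths S \<dots> (a +++ (p +++ (reversepath b +++ (b +++ ?qc))))"
    using assms by (intro homotopic_paths_join_right homotopic_paths_assoc') auto
  also have "homotopic_paths S \<dots> (a +++ (p +++ ?qc))"
    using assms by (intro homotopic_paths_join_right homotopic_paths_cancel_left) auto
  also have "homotopic_paths S \<dots> (conj_path a (p +++ q) c)"
    unfolding conj_path_def using assms
    by (intro homotopic_paths_join_right homotopic_paths_sym[OF homotopic_paths_assoc']) auto
  finally show ?thesis .
qed

lemma homotopic_paths_conj_path_reversepath:
  assumes "path_in S q" "path_in S l" "pathfinish q = pathstart l" "pathfinish l = pathstart l"
  shows "homotopic_paths S (conj_path (reversepath q) (conj_path q l q) (reversepath q)) l"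
proof -
  have "homotopic_paths S (conj_path (reversepath q) (conj_path q l q) (reversepath q))
      (reversepath q +++ (q +++ ((l +++ reversepath q) +++ q)))"
    unfolding conj_path_def reversepath_reversepath using assms
    by (intro homotopic_paths_join_right homotopic_paths_assoc') auto
  also have "homotopic_paths S \<dots> ((l +++ reversepath q) +++ q)"
    using assms by (intro homotopic_paths_cancel_left) auto
  also have "homotopic_paths S \<dots> (l +++ (reversepath q +++ q))"
    using assms by (intro homotopic_paths_assoc') auto
  also have "homotopic_paths S \<dots> (l +++ (\<lambda>_. pathfinish l))"
    using assms homotopic_paths_reverse_left[of S q] by (intro homotopic_paths_join_right) auto
  also have "homotopic_paths S \<dots> l"
    using assms homotopic_paths_const_right[of S l] by simp
  finally show ?thesis .
qed

section \<open>The fundamental group and the change of base point\<close>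

lemma loops_at_iff: "p \<in> loops_at S x \<longleftrightarrow> path_in S p \<and> pathstart p = x \<and> pathfinish p = x"
  by (auto simp: loops_at_def path_in_def)

lemma loops_at_join [simp]: "p \<in> loops_at S x \<Longrightarrow> q \<in> loops_at S x \<Longrightarrow> p +++ q \<in> loops_at S x"
  by (simp add: loops_at_iff)

lemma loops_at_reversepath [simp]: "p \<in> loops_at S x \<Longrightarrow> reversepath p \<in> loops_at S x"
  by (simp add: loops_at_iff)

lemma loops_at_const [simp]: "x \<in> S \<Longrightarrow> (\<lambda>_. x) \<in> loops_at S x"
  by (simp add: loops_at_iff pathstart_def pathfinish_def)

lemma homotopic_paths_loops_at:
  "homotopic_paths S p q \<Longrightarrow> p \<in> loops_at S x \<longleftrightarrow> q \<in> loops_at S x"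
  using homotopic_paths_path_in homotopic_paths_imp_pathstart homotopic_paths_imp_pathfinish
  unfolding loops_at_iff by metis

lemma loop_class_eq_iff:
  assumes "p \<in> loops_at S x"
  shows "loop_class S x p = loop_class S x q \<longleftrightarrow> homotopic_paths S p q"
proof
  assume "loop_class S x p = loop_class S x q"
  moreover have "p \<in> loop_class S x p"
    using assms by (auto simp: loop_class_def loops_at_iff)
  ultimately show "homotopic_paths S p q"
    by (auto simp: loop_class_def intro: homotopic_paths_sym)
next
  assume "homotopic_paths S p q"
  then show "loop_class S x p = loop_class S x q"
    unfolding loop_class_def by (metis homotopic_paths_sym homotopic_paths_trans)
qed

lemma loop_class_eqI:
  "p \<in> loops_at S x \<Longrightarrow> homotopic_paths S p q \<Longrightarrow> loop_class S x p = loop_class S x q"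
  by (simp add: loop_class_eq_iff)

lemma some_loop_class:
  assumes "p \<in> loops_at S x"
  shows "homotopic_paths S p (SOME q. q \<in> loop_class S x p)" "(SOME q. q \<in> loop_class S x p) \<in> loops_at S x"
proof -
  have "p \<in> loop_class S x p"
    using assms by (auto simp: loop_class_def loops_at_iff)
  then have "(SOME q. q \<in> loop_class S x p) \<in> loop_class S x p"
    by (metis someI)
  then show "homotopic_paths S p (SOME q. q \<in> loop_class S x p)"
    "(SOME q. q \<in> loop_class S x p) \<in> loops_at S x"
    by (auto simp: loop_class_def)
qed

lemma carrier_fundamental_group:
  "carrier (fundamental_group S x) = loop_class S x ` loops_at S x"
  by (simp add: fundamental_group_def)

lemma loop_class_in_fundamental_group [simp]:
  "p \<in> loops_at S x \<Longrightarrow> loop_class S x p \<in> carrier (fundamental_group S x)"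
  by (simp add: carrier_fundamental_group)

lemma one_fundamental_group: "\<one>\<^bsub>fundamental_group S x\<^esub> = loop_class S x (\<lambda>_. x)"
  by (simp add: fundamental_group_def)

text \<open>The multiplication is defined through chosen representatives; concatenation respects
  homotopy, so every other choice gives the same class.\<close>

lemma mult_fundamental_group:
  assumes "p \<in> loops_at S x" "q \<in> loops_at S x"
  shows "loop_class S x p \<otimes>\<^bsub>fundamental_group S x\<^esub> loop_class S x q = loop_class S x (p +++ q)"
proof -
  have "homotopic_paths S (p +++ q) ((SOME p'. p' \<in> loop_class S x p) +++ (SOME q'. q' \<in> loop_class S x q))"
    using assms some_loop_class by (intro homotopic_paths_join) (auto simp: loops_at_iff)
  then show ?thesis
    using assms loop_class_eqI[of "p +++ q" S x] by (simp add: fundamental_group_def)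
qed

lemma loop_class_reverse_left:
  assumes "p \<in> loops_at S x"
  shows "loop_class S x (reversepath p) \<otimes>\<^bsub>fundamental_group S x\<^esub> loop_class S x p
    = \<one>\<^bsub>fundamental_group S x\<^esub>"
  using assms homotopic_paths_reverse_left[of S p]
  by (simp add: mult_fundamental_group one_fundamental_group loop_class_eq_iff) (simp add: loops_at_iff)

lemma group_fundamental_group:
  assumes "x \<in> S"
  shows "group (fundamental_group S x)"
proof (rule groupI)
  fix A B C
  assume "A \<in> carrier (fundamental_group S x)" "B \<in> carrier (fundamental_group S x)"
    "C \<in> carrier (fundamental_group S x)"
  then obtain p q r where pqr: "A = loop_class S x p" "B = loop_class S x q" "C = loop_class S x r"
    "p \<in> loops_at S x" "q \<in> loops_at S x" "r \<in> loops_at S x"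
    by (auto simp: carrier_fundamental_group)
  then have "homotopic_paths S ((p +++ q) +++ r) (p +++ (q +++ r))"
    by (intro homotopic_paths_assoc') (auto simp: loops_at_iff)
  then show "A \<otimes>\<^bsub>fundamental_group S x\<^esub> B \<otimes>\<^bsub>fundamental_group S x\<^esub> C =
      A \<otimes>\<^bsub>fundamental_group S x\<^esub> (B \<otimes>\<^bsub>fundamental_group S x\<^esub> C)"
    using pqr by (simp add: mult_fundamental_group loop_class_eq_iff)
next
  fix A assume "A \<in> carrier (fundamental_group S x)"
  then obtain p where p: "A = loop_class S x p" "p \<in> loops_at S x"
    by (auto simp: carrier_fundamental_group)
  then show "\<one>\<^bsub>fundamental_group S x\<^esub> \<otimes>\<^bsub>fundamental_group S x\<^esub> A = A"
    using assms homotopic_paths_const_left[of S p]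
    by (simp add: one_fundamental_group mult_fundamental_group loop_class_eq_iff) (simp add: loops_at_iff)
  show "\<exists>B\<in>carrier (fundamental_group S x). B \<otimes>\<^bsub>fundamental_group S x\<^esub> A = \<one>\<^bsub>fundamental_group S x\<^esub>"
    using p loop_class_reverse_left[of p S x] by (intro bexI[of _ "loop_class S x (reversepath p)"]) auto
qed (use assms in \<open>auto simp: one_fundamental_group carrier_fundamental_group mult_fundamental_group\<close>)

lemma inv_fundamental_group:
  assumes "p \<in> loops_at S x"
  shows "inv\<^bsub>fundamental_group S x\<^esub> (loop_class S x p) = loop_class S x (reversepath p)"
proof -
  have "x \<in> S"
    using assms by (auto simp: loops_at_def path_image_def pathstart_def)
  then interpret group "fundamental_group S x" by (rule group_fundamental_group)
  show ?thesis
    using assms by (intro inv_equality loop_class_reverse_left) auto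
qed

text \<open>Travelling back along \<open>q\<close>, round a loop and out again is a homomorphism of
  fundamental groups that takes the class of the conjugated loop to the class of
  \<open>l\<close>.\<close>

lemma is_prod_of_commutators_conj_path:
  assumes q: "path_in S q" and l: "l \<in> loops_at S (pathfinish q)"
    and prod: "is_prod_of_commutators (fundamental_group S (pathstart q)) n
      (loop_class S (pathstart q) (conj_path q l q))"
  shows "is_prod_of_commutators (fundamental_group S (pathfinish q)) n (loop_class S (pathfinish q) l)"
proof -
  let ?x = "pathstart q" and ?y = "pathfinish q"
  let ?c = "\<lambda>p. conj_path (reversepath q) p (reversepath q)"
  define f where "f A = loop_class S ?y (?c (SOME p. p \<in> A))" for A
  have loops: "?c p \<in> loops_at S ?y" if "p \<in> loops_at S ?x" for p
    using q that by (simp add: loops_at_iff)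
  have f: "f (loop_class S ?x p) = loop_class S ?y (?c p)" if "p \<in> loops_at S ?x" for p
  proof -
    have "homotopic_paths S (?c p) (?c (SOME q. q \<in> loop_class S ?x p))"
      using some_loop_class[OF that] q that by (intro homotopic_paths_conj_path) (auto simp: loops_at_iff)
    then show ?thesis
      using loops[OF that] loop_class_eqI by (fastforce simp: f_def)
  qed
  have xy: "?x \<in> S" "?y \<in> S"
    using q by (auto simp: path_in_def)
  have "f \<in> hom (fundamental_group S ?x) (fundamental_group S ?y)"
  proof (rule homI)
    fix A B assume "A \<in> carrier (fundamental_group S ?x)" "B \<in> carrier (fundamental_group S ?x)"
    then obtain a b where ab: "A = loop_class S ?x a" "B = loop_class S ?x b"
      "a \<in> loops_at S ?x" "b \<in> loops_at S ?x"
      by (auto simp: carrier_fundamental_group)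
    have "homotopic_paths S (?c a +++ ?c b) (?c (a +++ b))"
      using q ab by (intro homotopic_paths_conj_path_join) (auto simp: loops_at_iff)
    then have "loop_class S ?y (?c (a +++ b)) = loop_class S ?y (?c a +++ ?c b)"
      using ab loops loop_class_eqI[of "?c a +++ ?c b"] by simp
    then show "f (A \<otimes>\<^bsub>fundamental_group S ?x\<^esub> B) = f A \<otimes>\<^bsub>fundamental_group S ?y\<^esub> f B"
      using ab loops by (simp add: f mult_fundamental_group)
  qed (auto simp: carrier_fundamental_group f loops)
  from hom_is_prod_of_commutators[OF group_fundamental_group group_fundamental_group this prod] xy
  have "is_prod_of_commutators (fundamental_group S ?y) n (f (loop_class S ?x (conj_path q l q)))"
    by blast
  moreover have "f (loop_class S ?x (conj_path q l q)) = loop_class S ?y l"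
  proof -
    have "conj_path q l q \<in> loops_at S ?x"
      using q l by (simp add: loops_at_iff)
    moreover have "homotopic_paths S (?c (conj_path q l q)) l"
      using q l by (intro homotopic_paths_conj_path_reversepath) (auto simp: loops_at_iff)
    ultimately show ?thesis
      using loops f by (simp add: loop_class_eq_iff)
  qed
  ultimately show ?thesis by simp
qed

section \<open>Injectivity of the Hurewicz map\<close>

lemma singular_simplex_top_of_set:
  "singular_simplex n (top_of_set X) f \<longleftrightarrow> continuous_on (standard_simplex n) f \<and>
    f ` standard_simplex n \<subseteq> X \<and> f \<in> extensional (standard_simplex n)"
  by (auto simp: singular_simplex_def euclidean_product_topology continuous_map_in_subtopology)

text \<open>The second barycentric coordinate plays the role of the path parameter. Singular
  simplices are extensional, hence the restriction.\<close>

definition simplex_of_path :: "(real \<Rightarrow> 'a) \<Rightarrow> (nat \<Rightarrow> real) \<Rightarrow> 'a" where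
  "simplex_of_path l = restrict (\<lambda>x. l (x 1)) (standard_simplex 1)"

definition path_of_simplex :: "((nat \<Rightarrow> real) \<Rightarrow> 'a) \<Rightarrow> real \<Rightarrow> 'a" where
  "path_of_simplex f t = f (\<lambda>i. if i = 0 then 1 - t else if i = 1 then t else 0)"

text \<open>A copy of the 2-simplex in the plane: \<open>homotopic_paths_compose\<close> uses
  straight-line homotopies in a normed space, whereas \<open>standard_simplex 2\<close> consists of
  functions on the natural numbers.\<close>

definition unit_triangle :: "(real \<times> real) set" where
  "unit_triangle = {(x, y). 0 \<le> x \<and> 0 \<le> y \<and> x + y \<le> 1}"

definition triangle_simplex :: "real \<times> real \<Rightarrow> nat \<Rightarrow> real" where
  "triangle_simplex z i = (if i = 0 then 1 - fst z - snd z else if i = 1 then fst z else if i = 2 then snd z else 0)"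

lemma edge_in_standard_simplex:
  "(\<lambda>i. if i = 0 then 1 - t else if i = 1 then t else 0) \<in> standard_simplex 1 \<longleftrightarrow> t \<in> {0..1}"
  by (auto simp: standard_simplex_def dest: spec[of _ 1])

lemma triangle_simplex_in_standard_simplex: "z \<in> unit_triangle \<Longrightarrow> triangle_simplex z \<in> standard_simplex 2"
  by (auto simp: unit_triangle_def standard_simplex_def triangle_simplex_def numeral_2_eq_2)

lemma convex_unit_triangle: "convex unit_triangle"
proof -
  have "unit_triangle = {z. (-1, 0) \<bullet> z \<le> 0} \<inter> {z. (0, -1) \<bullet> z \<le> 0} \<inter> {z. (1, 1) \<bullet> z \<le> 1}"
    by (auto simp: unit_triangle_def)
  then show ?thesis
    by (metis convex_Int convex_halfspace_le)
qed

lemma singular_simplex_simplex_of_path: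
  assumes "path_in X l"
  shows "singular_simplex 1 (top_of_set X) (simplex_of_path l)"
proof -
  have "x 1 \<in> {0..1}" if "x \<in> standard_simplex 1" for x
    using that by (auto simp: standard_simplex_def)
  moreover have "continuous_on (standard_simplex 1) (\<lambda>x :: nat \<Rightarrow> real. x 1)"
    by (rule continuous_on_subset[OF continuous_on_product_coordinates subset_UNIV])
  ultimately have "continuous_on (standard_simplex 1) (\<lambda>x. l (x 1))"
    using assms
    by (intro continuous_on_compose2[of "{0..1}" l "standard_simplex 1" "\<lambda>x. x 1"])
      (auto simp: path_in_def path_def)
  then have "continuous_on (standard_simplex 1) (simplex_of_path l)"
    by (rule continuous_on_eq) (simp add: simplex_of_path_def)
  moreover have "simplex_of_path l ` standard_simplex 1 \<subseteq> X"
    using \<open>\<And>x. x \<in> standard_simplex 1 \<Longrightarrow> x 1 \<in> {0..1}\<close> assms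
    by (auto simp: simplex_of_path_def path_in_def path_image_def)
  ultimately show ?thesis
    by (simp add: singular_simplex_top_of_set simplex_of_path_def)
qed

lemma singular_relcycle_simplex_of_path:
  assumes "l \<in> loops_at X x"
  shows "singular_relcycle 1 (top_of_set X) {} (frag_of (simplex_of_path l))"
proof -
  have l: "path_in X l" "l 0 = l 1"
    using assms by (auto simp: loops_at_iff pathstart_def pathfinish_def)
  have "simplical_face 0 z \<in> standard_simplex 1 \<and> simplical_face 1 z \<in> standard_simplex 1"
    if "z \<in> standard_simplex 0" for z
    using simplical_face_in_standard_simplex[of 1 0 z] simplical_face_in_standard_simplex[of 1 1 z] that by simp
  \<comment> \<open>The path is closed, so its two faces coincide and cancel in the
    boundary.\<close>
  then have "singular_face 1 0 (simplex_of_path l) = singular_face 1 1 (simplex_of_path l)"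
    using l(2) by (auto simp: singular_face_def simplex_of_path_def standard_simplex_0 simplical_face_def)
  then have "chain_boundary 1 (frag_of (simplex_of_path l)) = 0"
    by (simp add: chain_boundary_of)
  then show ?thesis
    using singular_simplex_simplex_of_path[OF l(1)] by (simp add: singular_cycle singular_chain_of)
qed

lemma path_in_path_of_simplex:
  assumes "singular_simplex 1 (top_of_set X) f"
  shows "path_in X (path_of_simplex f)"
proof -
  have f: "continuous_on (standard_simplex 1) f" "f ` standard_simplex 1 \<subseteq> X"
    using assms by (auto simp: singular_simplex_top_of_set)
  have "continuous_on {0..1} (\<lambda>t::real. \<lambda>i::nat. if i = 0 then 1 - t else if i = 1 then t else 0)"
  proof (rule continuous_on_coordinatewise_then_product)
    show "continuous_on {0..1} (\<lambda>t::real. if i = 0 then 1 - t else if i = 1 then t else 0)" for i :: nat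
      by (cases "i = 0"; cases "i = 1") (auto intro!: continuous_intros)
  qed
  then have "continuous_on {0..1} (path_of_simplex f)"
    unfolding path_of_simplex_def
    by (rule continuous_on_compose2[OF f(1)]) (use edge_in_standard_simplex in blast)
  then show ?thesis
    unfolding path_in_def path_def path_image_def path_of_simplex_def
    using f(2) edge_in_standard_simplex by blast
qed

lemma path_of_simplex_of_path: "t \<in> {0..1} \<Longrightarrow> path_of_simplex (simplex_of_path l) t = l t"
  using edge_in_standard_simplex[of t] by (simp add: path_of_simplex_def simplex_of_path_def)

lemma path_of_singular_face:
  assumes "t \<in> {0..1}"
  shows "path_of_simplex (singular_face 2 0 f) t = f (triangle_simplex (1 - t, t))"
    "path_of_simplex (singular_face 2 1 f) t = f (triangle_simplex (0, t))"
    "path_of_simplex (singular_face 2 2 f) t = f (triangle_simplex (t, 0))"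
proof -
  let ?e = "\<lambda>i::nat. if i = 0 then 1 - t else if i = 1 then t else 0"
  have eq: "path_of_simplex (singular_face 2 k f) t = f (simplical_face k ?e)" for k
    using edge_in_standard_simplex[of t] assms by (simp add: path_of_simplex_def singular_face_def)
  have e: "simplical_face 0 ?e = triangle_simplex (1 - t, t)"
    "simplical_face 1 ?e = triangle_simplex (0, t)" "simplical_face 2 ?e = triangle_simplex (t, 0)"
    by (auto simp: fun_eq_iff simplical_face_def triangle_simplex_def)
  show "path_of_simplex (singular_face 2 0 f) t = f (triangle_simplex (1 - t, t))"
    "path_of_simplex (singular_face 2 1 f) t = f (triangle_simplex (0, t))"
    "path_of_simplex (singular_face 2 2 f) t = f (triangle_simplex (t, 0))"
    by (simp_all only: eq e)
qed

text \<open>Faces 2, 0 and 1 are the edges from vertex 0 to 1, from 1 to 2 and from 0 to 2. In the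
  convex triangle the detour through vertex 1 and the direct edge have the same ends, so they are
  homotopic, and \<open>f\<close> carries the homotopy into \<open>X\<close>.\<close>

lemma homotopic_paths_faces:
  assumes f: "singular_simplex 2 (top_of_set X) f"
  shows "homotopic_paths X (path_of_simplex (singular_face 2 2 f) +++ path_of_simplex (singular_face 2 0 f))
    (path_of_simplex (singular_face 2 1 f))"
proof -
  let ?g = "f \<circ> triangle_simplex"
  define \<phi>0 \<phi>1 \<phi>2 :: "real \<Rightarrow> real \<times> real" where
    "\<phi>0 = (\<lambda>t. (1 - t, t))" and "\<phi>1 = (\<lambda>t. (0, t))" and "\<phi>2 = (\<lambda>t. (t, 0))"
  have face: "singular_simplex 1 (top_of_set X) (singular_face 2 k f)" if "k \<le> 2" for k
    using singular_simplex_singular_face[OF f _ that] by simp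
  have \<phi>: "path_in unit_triangle \<phi>0" "path_in unit_triangle \<phi>1" "path_in unit_triangle \<phi>2"
    by (auto simp: path_in_def path_def path_image_def unit_triangle_def \<phi>0_def \<phi>1_def \<phi>2_def
        intro!: continuous_intros)
  have ends: "pathfinish \<phi>2 = pathstart \<phi>0" "pathstart \<phi>2 = pathstart \<phi>1" "pathfinish \<phi>0 = pathfinish \<phi>1"
    by (auto simp: \<phi>0_def \<phi>1_def \<phi>2_def pathstart_def pathfinish_def)
  have "continuous_on unit_triangle triangle_simplex"
  proof (rule continuous_on_coordinatewise_then_product)
    show "continuous_on unit_triangle (\<lambda>z. triangle_simplex z i)" for i
      unfolding triangle_simplex_def
      by (cases "i = 0"; cases "i = 1"; cases "i = 2") (auto intro!: continuous_intros)
  qed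
  moreover have "continuous_on (standard_simplex 2) f" "f ` standard_simplex 2 \<subseteq> X"
    using f by (auto simp: singular_simplex_top_of_set)
  ultimately have "continuous_on unit_triangle ?g" "?g ` unit_triangle \<subseteq> X"
    using triangle_simplex_in_standard_simplex
    unfolding comp_def by (auto intro!: continuous_on_compose2[of "standard_simplex 2" f])
  then have g: "homotopic_paths X (?g \<circ> (\<phi>2 +++ \<phi>0)) (?g \<circ> \<phi>1)"
    using \<phi> ends by (intro homotopic_paths_compose[OF _ _ convex_unit_triangle]) auto
  have "homotopic_paths X (path_of_simplex (singular_face 2 k f)) (?g \<circ> \<phi>)"
    if "k \<le> 2" "\<And>t. t \<in> {0..1} \<Longrightarrow> path_of_simplex (singular_face 2 k f) t = f (triangle_simplex (\<phi> t))" for k \<phi>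
    using path_in_path_of_simplex[OF face[OF that(1)]] that(2)
    by (intro homotopic_paths_eq) (auto simp: path_in_def)
  then have e: "homotopic_paths X (path_of_simplex (singular_face 2 0 f)) (?g \<circ> \<phi>0)"
    "homotopic_paths X (path_of_simplex (singular_face 2 1 f)) (?g \<circ> \<phi>1)"
    "homotopic_paths X (path_of_simplex (singular_face 2 2 f)) (?g \<circ> \<phi>2)"
    using path_of_singular_face[of _ f] by (simp_all add: \<phi>0_def \<phi>1_def \<phi>2_def)
  have "pathfinish (path_of_simplex (singular_face 2 2 f)) = pathstart (path_of_simplex (singular_face 2 0 f))"
    using homotopic_paths_imp_pathfinish[OF e(3)] homotopic_paths_imp_pathstart[OF e(1)] ends(1)
    by (simp add: pathfinish_compose pathstart_compose)
  then have "homotopic_paths X (path_of_simplex (singular_face 2 2 f) +++ path_of_simplex (singular_face 2 0 f))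
      (?g \<circ> (\<phi>2 +++ \<phi>0))"
    unfolding path_compose_join by (intro homotopic_paths_join e)
  also note g
  also note homotopic_paths_sym[OF e(2)]
  finally show ?thesis .
qed

text \<open>The nontrivial half of Hurewicz's theorem: joining all vertices to the base point turns
  singular 1-chains into elements of the abelianised fundamental group, and boundaries of
  2-simplices become trivial.\<close>

lemma homologous_loops_derived:
  assumes X: "path_connected X" and l: "l \<in> loops_at X p" "l' \<in> loops_at X p"
    and hom: "homologous_rel 1 (top_of_set X) {} (frag_of (simplex_of_path l)) (frag_of (simplex_of_path l'))"
  shows "loop_class X p l \<otimes>\<^bsub>fundamental_group X p\<^esub> inv\<^bsub>fundamental_group X p\<^esub> loop_class X p l'
    \<in> derived (fundamental_group X p) (carrier (fundamental_group X p))"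
proof -
  define G where "G = fundamental_group X p"
  define D where "D = derived G (carrier G)"
  define A where "A = G Mod D"
  have p: "p \<in> X"
    using l by (auto simp: loops_at_def)
  interpret G: group G
    unfolding G_def using p by (rule group_fundamental_group)
  interpret A: comm_group A
    unfolding A_def D_def by (rule G.derived_quot_is_comm_group)
  interpret D: normal D G
    unfolding D_def by (rule G.derived_self_is_normal)
  define \<pi> where "\<pi> q = D #>\<^bsub>G\<^esub> loop_class X p q" for q
  have \<pi>_hom: "(\<lambda>a. D #>\<^bsub>G\<^esub> a) \<in> hom G A"
    unfolding A_def by (rule D.r_coset_hom_Mod)
  interpret pi: group_hom G A "\<lambda>a. D #>\<^bsub>G\<^esub> a"
    using \<pi>_hom by (simp add: group_hom_def group_hom_axioms_def A.is_group)
  have \<pi>_closed: "\<pi> q \<in> carrier A" if "q \<in> loops_at X p" for q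
    using hom_in_carrier[OF \<pi>_hom] that by (simp add: \<pi>_def G_def)
  have \<pi>_join: "\<pi> (q +++ r) = \<pi> q \<otimes>\<^bsub>A\<^esub> \<pi> r" if "q \<in> loops_at X p" "r \<in> loops_at X p" for q r
    using hom_mult[OF \<pi>_hom, of "loop_class X p q" "loop_class X p r"] that
    by (simp add: \<pi>_def G_def mult_fundamental_group)
  have \<pi>_cong: "\<pi> q = \<pi> r" if "q \<in> loops_at X p" "homotopic_paths X q r" for q r
    using loop_class_eqI[OF that] by (simp add: \<pi>_def)
  have "\<exists>\<gamma>. \<forall>y\<in>X. path_in X (\<gamma> y) \<and> pathstart (\<gamma> y) = p \<and> pathfinish (\<gamma> y) = y"
    using X p unfolding path_connected_def path_in_def by (intro bchoice) blast
  then obtain \<gamma> where \<gamma>: "\<And>y. y \<in> X \<Longrightarrow> path_in X (\<gamma> y)" "\<And>y. y \<in> X \<Longrightarrow> pathstart (\<gamma> y) = p"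
    "\<And>y. y \<in> X \<Longrightarrow> pathfinish (\<gamma> y) = y"
    by blast
  define c where "c q = conj_path (\<gamma> (pathstart q)) q (\<gamma> (pathfinish q))" for q
  have ends: "pathstart q \<in> X" "pathfinish q \<in> X" if "path_in X q" for q
    using that by (auto simp: path_in_def)
  have c_loop: "c q \<in> loops_at X p" if "path_in X q" for q
    using that \<gamma> ends[OF that] by (simp add: c_def loops_at_iff)
  have c_cong: "\<pi> (c q) = \<pi> (c r)" if "homotopic_paths X q r" for q r
  proof (rule \<pi>_cong)
    have "path_in X q" using that homotopic_paths_path_in by blast
    then show "c q \<in> loops_at X p" by (rule c_loop)
    show "homotopic_paths X (c q) (c r)"
      using that \<gamma> ends[OF \<open>path_in X q\<close>] homotopic_paths_imp_pathstart[OF that] homotopic_paths_imp_pathfinish[OF that]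
      unfolding c_def by (auto intro!: homotopic_paths_conj_path)
  qed
  have c_join: "\<pi> (c (q +++ r)) = \<pi> (c q) \<otimes>\<^bsub>A\<^esub> \<pi> (c r)"
    if "path_in X q" "path_in X r" "pathfinish q = pathstart r" for q r
  proof -
    have "homotopic_paths X (c q +++ c r) (c (q +++ r))"
      using that \<gamma> ends[OF that(1)] ends[OF that(2)] unfolding c_def
      by (auto intro!: homotopic_paths_conj_path_join)
    then have "\<pi> (c q +++ c r) = \<pi> (c (q +++ r))"
      using that c_loop by (intro \<pi>_cong) auto
    then show ?thesis
      using that c_loop \<pi>_join by simp
  qed
  \<comment> \<open>The path chosen from \<open>p\<close> to itself may be an essential loop;
    conjugation by it disappears because \<open>A\<close> is commutative.\<close>
  have c_of_loop: "\<pi> (c q) = \<pi> q" if q: "q \<in> loops_at X p" for q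
  proof -
    have \<gamma>p: "\<gamma> p \<in> loops_at X p"
      using \<gamma> p by (simp add: loops_at_iff)
    have "inv\<^bsub>G\<^esub> loop_class X p (\<gamma> p) = loop_class X p (reversepath (\<gamma> p))"
      using inv_fundamental_group[OF \<gamma>p] by (simp add: G_def)
    then have inv: "\<pi> (reversepath (\<gamma> p)) = inv\<^bsub>A\<^esub> \<pi> (\<gamma> p)"
      using pi.hom_inv[of "loop_class X p (\<gamma> p)"] \<gamma>p by (simp add: \<pi>_def G_def)
    have "c q = \<gamma> p +++ (q +++ reversepath (\<gamma> p))"
      using q by (simp add: c_def conj_path_def loops_at_iff)
    then have "\<pi> (c q) = \<pi> (\<gamma> p) \<otimes>\<^bsub>A\<^esub> (\<pi> q \<otimes>\<^bsub>A\<^esub> inv\<^bsub>A\<^esub> \<pi> (\<gamma> p))"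
      using q \<gamma>p by (simp add: \<pi>_join inv)
    also have "\<dots> = \<pi> q \<otimes>\<^bsub>A\<^esub> (\<pi> (\<gamma> p) \<otimes>\<^bsub>A\<^esub> inv\<^bsub>A\<^esub> \<pi> (\<gamma> p))"
      using q \<gamma>p \<pi>_closed by (intro A.m_lcomm A.inv_closed) auto
    finally show ?thesis
      using q \<gamma>p \<pi>_closed by simp
  qed
  let ?S = "singular_simplex_set 1 (top_of_set X)"
  define f where "f \<sigma> = \<pi> (c (path_of_simplex \<sigma>))" for \<sigma>
  have "f ` ?S \<subseteq> carrier A"
    using \<pi>_closed c_loop path_in_path_of_simplex by (auto simp: f_def)
  \<comment> \<open>The universal property of the chain group, which asks for a commutative target,
    extends \<open>f\<close> from simplices to chains.\<close>
  then obtain h where h: "h \<in> hom (free_Abelian_group ?S) A" "\<And>\<sigma>. \<sigma> \<in> ?S \<Longrightarrow> h (frag_of \<sigma>) = f \<sigma>"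
    by (rule A.free_Abelian_group_universal) (rule that, assumption, blast)
  have h_hom: "group_hom (free_Abelian_group ?S) A h"
    unfolding group_hom_def group_hom_axioms_def using h(1) A.is_group group_free_Abelian_group by blast
  have h_diff: "h (a - b) = h a \<otimes>\<^bsub>A\<^esub> inv\<^bsub>A\<^esub> h b"
    if "singular_chain 1 (top_of_set X) a" "singular_chain 1 (top_of_set X) b" for a b
  proof -
    have ab: "Poly_Mapping.keys a \<subseteq> ?S" "Poly_Mapping.keys b \<subseteq> ?S"
      using that by (simp_all add: singular_chain_def)
    then have "h (a + (- b)) = h a \<otimes>\<^bsub>A\<^esub> h (- b)"
      using hom_mult[OF h(1), of a "- b"] by simp
    moreover have "h (- b) = inv\<^bsub>A\<^esub> h b"
      using group_hom.hom_inv[OF h_hom, of b] ab by simp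
    ultimately show ?thesis by simp
  qed
  have h_boundary_of: "h (chain_boundary 2 (frag_of \<tau>)) = \<one>\<^bsub>A\<^esub>" if \<tau>: "singular_simplex 2 (top_of_set X) \<tau>" for \<tau>
  proof -
    let ?e = "\<lambda>k. singular_face 2 k \<tau>"
    have face: "singular_simplex 1 (top_of_set X) (?e k)" if "k \<le> 2" for k
      using singular_simplex_singular_face[OF \<tau> _ that] by simp
    then have path: "path_in X (path_of_simplex (?e k))" if "k \<le> 2" for k
      using path_in_path_of_simplex that by blast
    have closed: "f (?e k) \<in> carrier A" if "k \<le> 2" for k
      using \<open>f ` ?S \<subseteq> carrier A\<close> face[OF that] by auto
    \<comment> \<open>The alternating sum is written with differences only, so that
      \<open>h_diff\<close> applies to it twice.\<close>
    have "chain_boundary 2 (frag_of \<tau>) = frag_of (?e 2) - (frag_of (?e 1) - frag_of (?e 0))"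
      by (simp add: chain_boundary_of numeral_2_eq_2)
    then have "h (chain_boundary 2 (frag_of \<tau>)) = f (?e 2) \<otimes>\<^bsub>A\<^esub> inv\<^bsub>A\<^esub> (f (?e 1) \<otimes>\<^bsub>A\<^esub> inv\<^bsub>A\<^esub> f (?e 0))"
      using face by (simp add: h_diff singular_chain_of singular_chain_diff h(2))
    also have "f (?e 1) = \<pi> (c (path_of_simplex (?e 2) +++ path_of_simplex (?e 0)))"
      unfolding f_def using homotopic_paths_faces[OF \<tau>] c_cong by metis
    also have "\<dots> = f (?e 2) \<otimes>\<^bsub>A\<^esub> f (?e 0)"
      unfolding f_def
    proof (rule c_join)
      show "pathfinish (path_of_simplex (?e 2)) = pathstart (path_of_simplex (?e 0))"
        using path_of_singular_face[of 0 \<tau>] path_of_singular_face[of 1 \<tau>]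
        by (simp add: pathstart_def pathfinish_def)
    qed (simp_all add: path)
    also have "f (?e 2) \<otimes>\<^bsub>A\<^esub> inv\<^bsub>A\<^esub> (f (?e 2) \<otimes>\<^bsub>A\<^esub> f (?e 0) \<otimes>\<^bsub>A\<^esub> inv\<^bsub>A\<^esub> f (?e 0)) = \<one>\<^bsub>A\<^esub>"
      using closed[of 0] closed[of 2] by (simp add: A.m_assoc)
    finally show ?thesis .
  qed
  have h_boundary: "h (chain_boundary 2 d) = \<one>\<^bsub>A\<^esub>" if "singular_chain 2 (top_of_set X) d" for d
  proof -
    have "Poly_Mapping.keys d \<subseteq> singular_simplex_set 2 (top_of_set X)"
      using that by (simp add: singular_chain_def)
    then show ?thesis
    proof (rule free_Abelian_group_induct)
      show "h (chain_boundary 2 0) = \<one>\<^bsub>A\<^esub>"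
        using group_hom.hom_one[OF h_hom] by simp
    next
      fix x y
      assume xy: "Poly_Mapping.keys x \<subseteq> singular_simplex_set 2 (top_of_set X)"
        "Poly_Mapping.keys y \<subseteq> singular_simplex_set 2 (top_of_set X)"
        "h (chain_boundary 2 x) = \<one>\<^bsub>A\<^esub>" "h (chain_boundary 2 y) = \<one>\<^bsub>A\<^esub>"
      then have "singular_chain 1 (top_of_set X) (chain_boundary 2 x)" "singular_chain 1 (top_of_set X) (chain_boundary 2 y)"
        using singular_chain_boundary[of 2 "top_of_set X"] by (simp_all add: singular_chain_def)
      with xy show "h (chain_boundary 2 (x - y)) = \<one>\<^bsub>A\<^esub>"
        by (simp add: chain_boundary_diff h_diff)
    qed (use h_boundary_of in simp)
  qed
  have "\<exists>d. singular_chain (Suc 1) (top_of_set X) d \<and>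
      chain_boundary (Suc 1) d = frag_of (simplex_of_path l) - frag_of (simplex_of_path l')"
    using hom by (simp only: homologous_rel_def singular_boundary)
  then obtain d where d: "singular_chain 2 (top_of_set X) d"
    "chain_boundary 2 d = frag_of (simplex_of_path l) - frag_of (simplex_of_path l')"
    unfolding Suc_1 by blast
  have simplex: "singular_simplex 1 (top_of_set X) (simplex_of_path q)" "f (simplex_of_path q) = \<pi> q"
    if "q \<in> loops_at X p" for q
  proof -
    have q: "path_in X q" using that by (simp add: loops_at_iff)
    then show "singular_simplex 1 (top_of_set X) (simplex_of_path q)"
      by (rule singular_simplex_simplex_of_path)
    have "homotopic_paths X q (path_of_simplex (simplex_of_path q))"
      using q path_of_simplex_of_path[of _ q] by (intro homotopic_paths_eq) (auto simp: path_in_def)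
    then show "f (simplex_of_path q) = \<pi> q"
      using c_cong c_of_loop[OF that] by (simp add: f_def)
  qed
  have "\<pi> l \<otimes>\<^bsub>A\<^esub> inv\<^bsub>A\<^esub> \<pi> l' = h (frag_of (simplex_of_path l) - frag_of (simplex_of_path l'))"
    using l simplex by (simp add: h_diff singular_chain_of h(2))
  also have "\<dots> = \<one>\<^bsub>A\<^esub>"
    using h_boundary d by metis
  finally have eq: "\<pi> l \<otimes>\<^bsub>A\<^esub> inv\<^bsub>A\<^esub> \<pi> l' = \<one>\<^bsub>A\<^esub>" .
  let ?a = "loop_class X p l" and ?b = "loop_class X p l'"
  have ab: "?a \<in> carrier G" "?b \<in> carrier G"
    using l by (simp_all add: G_def)
  have "D #>\<^bsub>G\<^esub> (?a \<otimes>\<^bsub>G\<^esub> inv\<^bsub>G\<^esub> ?b) = D"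
    using eq ab by (simp add: \<pi>_def pi.hom_mult pi.hom_inv) (simp add: A_def FactGroup_def)
  moreover have "?a \<otimes>\<^bsub>G\<^esub> inv\<^bsub>G\<^esub> ?b \<in> carrier G"
    using ab by simp
  ultimately have "?a \<otimes>\<^bsub>G\<^esub> inv\<^bsub>G\<^esub> ?b \<in> D"
    by (rule G.coset_join1[OF _ _ D.subgroup_axioms])
  then show ?thesis
    by (simp add: D_def G_def)
qed

section \<open>Infinite concatenations of loops\<close>

definition node :: "nat \<Rightarrow> real" where
  "node n = 1 - 1 / (real n + 1)"

lemma node_0 [simp]: "node 0 = 0" by (simp add: node_def)

lemma node_less_1 [simp]: "node n < 1" by (simp add: node_def)

lemma node_less_iff [simp]: "node m < node n \<longleftrightarrow> m < n"
  by (simp add: node_def field_simps)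

lemma node_le_iff [simp]: "node m \<le> node n \<longleftrightarrow> m \<le> n"
  by (meson linorder_not_less node_less_iff)

lemma node_nonneg [simp]: "0 \<le> node n"
  using node_le_iff[of 0 n] by simp

definition block :: "real \<Rightarrow> nat" where
  "block t = (LEAST n. t < node (Suc n))"

lemma block_eqI:
  assumes "node n \<le> t" "t < node (Suc n)" shows "block t = n"
  unfolding block_def
proof (rule Least_equality)
  fix m assume "t < node (Suc m)"
  with assms(1) have "node n < node (Suc m)" by linarith
  then show "n \<le> m" unfolding node_less_iff by simp
qed (use assms in auto)

lemma block_bounds:
  assumes "0 \<le> t" "t < 1" shows "node (block t) \<le> t" "t < node (Suc (block t))"
proof -
  obtain n :: nat where "n > 1 / (1 - t)" using reals_Archimedean2 by blast
  then have "t < node (Suc n)"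
    using assms by (simp add: node_def field_simps)
  then show *: "t < node (Suc (block t))"
    unfolding block_def by (rule LeastI)
  show "node (block t) \<le> t"
  proof (cases "block t")
    case (Suc m)
    then have "\<not> t < node (Suc m)"
      using not_less_Least[of m "\<lambda>n. t < node (Suc n)"] by (simp add: block_def)
    then show ?thesis using Suc by simp
  qed (use assms in simp)
qed

text \<open>A loop that is left out is replaced by a pause at \<open>x\<close> of the same duration.
  The time schedule is therefore the same for every \<alpha>, and each value depends on a single bit
  of \<alpha>.\<close>

definition inf_concat :: "'a \<Rightarrow> (nat \<Rightarrow> real \<Rightarrow> 'a) \<Rightarrow> (nat \<Rightarrow> bool) \<Rightarrow> real \<Rightarrow> 'a" where
  "inf_concat x c \<alpha> t = (let n = block t in
     if t < 1 \<and> \<alpha> n then c n ((t - node n) / (node (Suc n) - node n)) else x)"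

lemma inf_concat_cong: "\<alpha> (block t) = \<beta> (block t) \<Longrightarrow> inf_concat x c \<alpha> t = inf_concat x c \<beta> t"
  by (simp add: inf_concat_def Let_def)

lemma inf_concat_ge_1: "1 \<le> t \<Longrightarrow> inf_concat x c \<alpha> t = x"
  by (simp add: inf_concat_def Let_def)

locale null_sequence_of_loops =
  fixes X :: "'a::metric_space set" and x :: 'a and c :: "nat \<Rightarrow> real \<Rightarrow> 'a"
  assumes loops: "\<And>n. c n \<in> loops_at X x"
    and null: "\<And>n. path_image (c n) \<subseteq> ball x (1 / (real n + 1))"
begin

abbreviation L where "L \<equiv> inf_concat x c"

lemma base_in: "x \<in> X"
  using loops[of 0] by (auto simp: loops_at_def)

lemma c_ends [simp]: "c n 0 = x" "c n 1 = x"
  using loops[of n] by (auto simp: loops_at_def pathstart_def pathfinish_def)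

lemma L_node [simp]: "L \<alpha> (node n) = x"
proof -
  have "block (node n) = n" by (rule block_eqI) auto
  then show ?thesis by (simp add: inf_concat_def)
qed

lemma L_block:
  assumes "node n \<le> t" "t \<le> node (Suc n)"
  shows "L \<alpha> t = (if \<alpha> n then c n ((t - node n) / (node (Suc n) - node n)) else x)"
proof (cases "t = node (Suc n)")
  case True
  moreover have "node (Suc n) \<noteq> node n" using node_less_iff[of n "Suc n"] by linarith
  ultimately show ?thesis by simp
next
  case False
  then have "block t = n" "t < 1"
    using assms node_less_1[of "Suc n"] by (auto intro: block_eqI simp del: node_less_1)
  then show ?thesis by (simp add: inf_concat_def)
qed

lemma block_arg_in_01:
  assumes "node n \<le> t" "t \<le> node (Suc n)"
  shows "(t - node n) / (node (Suc n) - node n) \<in> {0..1}"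
proof -
  have "0 < node (Suc n) - node n" using node_less_iff[of n "Suc n"] by simp
  then show ?thesis using assms by simp
qed

text \<open>The tail meets only pauses and loops with index at least \<open>n\<close>. The bound is
  uniform in the parameter, which is what the continuity at 1 rests on.\<close>

lemma L_near:
  assumes "0 \<le> t" "node n \<le> t"
  shows "dist (L \<alpha> t) x < 1 / (real n + 1)"
proof (cases "t < 1")
  case True
  let ?m = "block t"
  let ?s = "(t - node ?m) / (node (Suc ?m) - node ?m)"
  have t: "node ?m \<le> t" "t < node (Suc ?m)" using block_bounds assms(1) True by auto
  then have "node n < node (Suc ?m)" using assms(2) by linarith
  then have "n \<le> ?m" unfolding node_less_iff by simp
  have "?s \<in> {0..1}" using t block_arg_in_01 by simp
  then have "c ?m ?s \<in> path_image (c ?m)"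
    unfolding path_image_def by (rule imageI)
  then have "c ?m ?s \<in> ball x (1 / (real ?m + 1))"
    using null[of ?m] by blast
  moreover have "1 / (real ?m + 1) \<le> 1 / (real n + 1)"
    using \<open>n \<le> ?m\<close> by (simp add: frac_le)
  ultimately show ?thesis
    using L_block[of ?m t \<alpha>] t by (auto simp: dist_commute)
qed (simp add: inf_concat_ge_1)

lemma L_in: assumes "0 \<le> t" shows "L \<alpha> t \<in> X"
proof (cases "t < 1")
  case True
  let ?m = "block t"
  have t: "node ?m \<le> t" "t < node (Suc ?m)" using block_bounds assms True by auto
  then have "c ?m ((t - node ?m) / (node (Suc ?m) - node ?m)) \<in> path_image (c ?m)"
    unfolding path_image_def using block_arg_in_01 by (intro imageI) simp
  then show ?thesis
    using L_block[of ?m t \<alpha>] t loops[of ?m] base_in by (auto simp: loops_at_def)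
qed (simp add: inf_concat_ge_1 base_in)

lemma continuous_on_L_initial: "continuous_on {0..node n} (L \<alpha>)"
proof (induction n)
  case (Suc n)
  have "continuous_on {node n..node (Suc n)} (L \<alpha>)"
  proof (cases "\<alpha> n")
    case True
    have "continuous_on {node n..node (Suc n)} (\<lambda>t. c n ((t - node n) / (node (Suc n) - node n)))"
    proof (rule continuous_on_compose2[of "{0..1}" "c n"])
      show "continuous_on {0..1} (c n)" using loops[of n] by (auto simp: loops_at_def path_def)
      show "continuous_on {node n..node (Suc n)} (\<lambda>t. (t - node n) / (node (Suc n) - node n))"
        using node_less_iff[of n "Suc n"] by (intro continuous_intros) (simp del: node_less_iff)
      show "(\<lambda>t. (t - node n) / (node (Suc n) - node n)) ` {node n..node (Suc n)} \<subseteq> {0..1}"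
        using block_arg_in_01 by auto
    qed
    then show ?thesis
      by (rule continuous_on_eq) (use True in \<open>auto simp: L_block\<close>)
  next
    case False
    then show ?thesis
      by (intro continuous_on_eq[OF continuous_on_const[of _ x]]) (auto simp: L_block)
  qed
  with Suc have "continuous_on ({0..node n} \<union> {node n..node (Suc n)}) (L \<alpha>)"
    by (intro continuous_on_closed_Un) auto
  then show ?case by (simp add: ivl_disj_un)
qed simp

text \<open>A uniform limit of truncations that rest at \<open>x\<close> from \<open>node n\<close>
  on.\<close>

lemma continuous_on_L: "continuous_on {0..1} (L \<alpha>)"
proof (rule uniform_limit_theorem)
  let ?f = "\<lambda>n t. if t \<le> node n then L \<alpha> t else x"
  show "eventually (\<lambda>n. continuous_on {0..1} (?f n)) sequentially"
  proof (intro always_eventually allI)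
    fix n
    have "continuous_on ({0..node n} \<union> {node n..1}) (?f n)"
      by (rule continuous_on_cases) (auto simp: continuous_on_L_initial)
    moreover have "{0..node n} \<union> {node n..1} = {0..1}"
      using node_less_1[of n] node_nonneg[of n] by (auto simp del: node_less_1 node_nonneg)
    ultimately show "continuous_on {0..1} (?f n)" by simp
  qed
  show "uniform_limit {0..1} ?f (L \<alpha>) sequentially"
  proof (rule uniform_limitI)
    fix e :: real assume "e > 0"
    then have "eventually (\<lambda>n::nat. 1 / (real n + 1) < e) sequentially"
      by real_asymp
    then show "\<forall>\<^sub>F n in sequentially. \<forall>t\<in>{0..1}. dist (?f n t) (L \<alpha> t) < e"
    proof (rule eventually_mono)
      fix n assume n: "1 / (real n + 1) < e"
      show "\<forall>t\<in>{0..1}. dist (?f n t) (L \<alpha> t) < e"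
      proof
        fix t :: real assume "t \<in> {0..1}"
        then show "dist (?f n t) (L \<alpha> t) < e"
          using L_near[of t n \<alpha>] n \<open>e > 0\<close> by (auto simp: dist_commute)
      qed
    qed
  qed
qed simp

lemma L_loop: "L \<alpha> \<in> loops_at X x"
proof -
  have "L \<alpha> 0 = x" using L_node[of \<alpha> 0] by simp
  then show ?thesis
    using continuous_on_L[of \<alpha>] L_in[of _ \<alpha>]
    by (auto simp: loops_at_def path_def path_image_def pathstart_def pathfinish_def inf_concat_ge_1)
qed

text \<open>For fixed \<open>t\<close> only the bit \<alpha> (\<open>block t\<close>) matters.
  Continuity at each single \<open>t\<close> is all that
  \<open>closed_encodes_commutator_homotopy\<close> requires.\<close>

lemma continuous_on_L_index: "continuous_on UNIV (\<lambda>\<alpha>. L \<alpha> t)"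
proof -
  let ?g = "\<lambda>b. L (\<lambda>_. b) t"
  have "continuous_on UNIV (\<lambda>\<alpha>. ?g (\<alpha> (block t)))"
    by (rule continuous_on_compose2[OF _ continuous_on_product_coordinates])
      (auto simp: continuous_on_open_vimage open_discrete)
  moreover have "?g (\<alpha> (block t)) = L \<alpha> t" for \<alpha>
    by (rule inf_concat_cong) simp
  ultimately show ?thesis by simp
qed

text \<open>The identity of the unit interval is homotopic, with fixed ends, to the concatenation of
  its three affine pieces \<phi>; composing with \<open>L\<close> \<alpha> gives the
  decomposition.\<close>

lemma L_split:
  defines "\<phi> \<equiv> \<lambda>u v t :: real. u + t * (v - u)"
  shows "L \<alpha> \<circ> \<phi> (node m) (node n) \<in> loops_at X x" "L \<alpha> \<circ> \<phi> (node n) 1 \<in> loops_at X x"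
    "homotopic_paths X (L \<alpha>) ((L \<alpha> \<circ> \<phi> 0 (node n)) +++
      ((L \<alpha> \<circ> \<phi> (node n) (node (Suc n))) +++ (L \<alpha> \<circ> \<phi> (node (Suc n)) 1)))"
proof -
  have \<phi>_in: "path_in {0..1} (\<phi> u v)" if "u \<in> {0..1}" "v \<in> {0..1}" for u v
  proof -
    have "\<phi> u v t \<in> {0..1}" if "t \<in> {0..1}" for t
    proof -
      have "\<phi> u v t = (1 - t) * u + t * v" by (simp add: \<phi>_def algebra_simps)
      moreover have "(1 - t) * u + t * v \<in> {0..1}"
        using convexD_alt[of "{0..1::real}" u v t] \<open>u \<in> _\<close> \<open>v \<in> _\<close> that by simp
      ultimately show ?thesis by simp
    qed
    then show ?thesis
      by (auto simp: path_in_def path_def path_image_def \<phi>_def intro!: continuous_intros)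
  qed
  have L: "path_in X (L \<alpha>)" using L_loop[of \<alpha>] by (simp add: loops_at_iff)
  have comp: "path_in X (L \<alpha> \<circ> \<psi>)" if "path_in {0..1} \<psi>" for \<psi> :: "real \<Rightarrow> real"
    using homotopic_paths_compose_01[OF L that that] by simp
  have L1: "L \<alpha> 1 = x" by (simp add: inf_concat_ge_1)
  have nodes: "node k \<in> {0..1}" for k using less_imp_le[OF node_less_1[of k]] by simp
  show "L \<alpha> \<circ> \<phi> (node m) (node n) \<in> loops_at X x" "L \<alpha> \<circ> \<phi> (node n) 1 \<in> loops_at X x"
    using comp[OF \<phi>_in] nodes L1 by (auto simp: loops_at_iff pathstart_def pathfinish_def \<phi>_def)
  let ?\<psi> = "\<phi> 0 (node n) +++ (\<phi> (node n) (node (Suc n)) +++ \<phi> (node (Suc n)) 1)"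
  have ends: "pathstart (\<phi> u v) = u" "pathfinish (\<phi> u v) = v" for u v
    by (simp_all add: \<phi>_def pathstart_def pathfinish_def)
  have "path_in {0..1} ?\<psi>"
    using nodes by (intro path_in_join \<phi>_in) (simp_all add: ends)
  then have "homotopic_paths X (L \<alpha> \<circ> (\<lambda>t. t)) (L \<alpha> \<circ> ?\<psi>)"
    using L path_in_id by (intro homotopic_paths_compose_01) (simp_all add: ends, simp_all add: pathstart_def pathfinish_def)
  then show "homotopic_paths X (L \<alpha>) ((L \<alpha> \<circ> \<phi> 0 (node n)) +++
      ((L \<alpha> \<circ> \<phi> (node n) (node (Suc n))) +++ (L \<alpha> \<circ> \<phi> (node (Suc n)) 1)))"
    unfolding path_compose_join by (simp add: comp_def)
qed

text \<open>With the parts before, on and after block \<open>n\<close> written \<open>P\<close>,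
  \<open>Q\<close>, \<open>R\<close>, the two loops have the classes \<open>P (c n) R\<close> and
  \<open>P R\<close>, so that their quotient is \<open>P (c n)\<close> times the inverse of
  \<open>P\<close>.\<close>

lemma loop_class_L_flip:
  assumes "\<alpha> n" "\<not> \<beta> n" "\<And>i. i \<noteq> n \<Longrightarrow> \<alpha> i = \<beta> i"
  shows "\<exists>p\<in>carrier (fundamental_group X x).
    loop_class X x (L \<alpha>) \<otimes>\<^bsub>fundamental_group X x\<^esub> inv\<^bsub>fundamental_group X x\<^esub> loop_class X x (L \<beta>)
     = p \<otimes>\<^bsub>fundamental_group X x\<^esub> loop_class X x (c n) \<otimes>\<^bsub>fundamental_group X x\<^esub> inv\<^bsub>fundamental_group X x\<^esub> p"
proof -
  define G where "G = fundamental_group X x"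
  interpret group G unfolding G_def using base_in by (rule group_fundamental_group)
  define \<phi> where "\<phi> = (\<lambda>u v t :: real. u + t * (v - u))"
  let ?cls = "loop_class X x"
  define P Q R where "P \<gamma> = L \<gamma> \<circ> \<phi> 0 (node n)" and "Q \<gamma> = L \<gamma> \<circ> \<phi> (node n) (node (Suc n))"
    and "R \<gamma> = L \<gamma> \<circ> \<phi> (node (Suc n)) 1" for \<gamma>
  have PQR: "P \<gamma> \<in> loops_at X x" "Q \<gamma> \<in> loops_at X x" "R \<gamma> \<in> loops_at X x" for \<gamma>
    using L_split(1)[of \<gamma> 0 n] L_split(1)[of \<gamma> n "Suc n"] L_split(2)[of \<gamma> "Suc n"]
    by (simp_all add: P_def Q_def R_def \<phi>_def)
  have split: "?cls (L \<gamma>) = ?cls (P \<gamma>) \<otimes>\<^bsub>G\<^esub> (?cls (Q \<gamma>) \<otimes>\<^bsub>G\<^esub> ?cls (R \<gamma>))" for \<gamma>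
  proof -
    have "homotopic_paths X (L \<gamma>) (P \<gamma> +++ (Q \<gamma> +++ R \<gamma>))"
      unfolding P_def Q_def R_def \<phi>_def by (rule L_split(3))
    then show ?thesis
      using PQR loop_class_eqI[OF L_loop] by (simp add: G_def mult_fundamental_group)
  qed
  have eqI: "?cls p = ?cls q" if "p \<in> loops_at X x" "\<And>t. t \<in> {0..1} \<Longrightarrow> p t = q t" for p q
    using that by (intro loop_class_eqI homotopic_paths_eq) (auto simp: loops_at_def)
  have "?cls (P \<alpha>) = ?cls (P \<beta>)"
  proof (rule eqI[OF PQR(1)])
    fix t :: real assume t: "t \<in> {0..1}"
    \<comment> \<open>The right end \<open>node n\<close> belongs to block \<open>n\<close>, where
      \<alpha> and \<beta> differ, but both loops pass through \<open>x\<close> there. All smaller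
      parameters lie in blocks before \<open>n\<close>.\<close>
    show "P \<alpha> t = P \<beta> t"
    proof (cases "\<phi> 0 (node n) t = node n")
      case True
      then show ?thesis by (simp add: P_def)
    next
      case False
      have "\<phi> 0 (node n) t \<le> node n" "0 \<le> \<phi> 0 (node n) t"
        using t mult_right_mono[of t 1 "node n"] by (auto simp: \<phi>_def)
      then have "\<phi> 0 (node n) t < node n" "0 \<le> \<phi> 0 (node n) t" using False by auto
      moreover then have "\<phi> 0 (node n) t < 1" using node_less_1[of n] by linarith
      ultimately have "node (block (\<phi> 0 (node n) t)) < node n"
        using block_bounds(1)[of "\<phi> 0 (node n) t"] by linarith
      then show ?thesis
        using assms(3) inf_concat_cong[of \<alpha> "\<phi> 0 (node n) t" \<beta>] by (auto simp: P_def)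
    qed
  qed
  moreover have "?cls (R \<alpha>) = ?cls (R \<beta>)"
  proof (rule eqI[OF PQR(3)])
    fix t :: real assume t: "t \<in> {0..1}"
    let ?s = "\<phi> (node (Suc n)) 1 t"
    have s: "node (Suc n) \<le> ?s"
      using t less_imp_le[OF node_less_1[of "Suc n"]] by (simp add: \<phi>_def)
    show "R \<alpha> t = R \<beta> t"
    proof (cases "?s < 1")
      case True
      moreover have "0 \<le> ?s" using s node_nonneg[of "Suc n"] by linarith
      ultimately have "?s < node (Suc (block ?s))" using block_bounds(2) by blast
      then have "node (Suc n) < node (Suc (block ?s))" using s by linarith
      then show ?thesis
        using assms(3) inf_concat_cong[of \<alpha> ?s \<beta>] by (auto simp: R_def)
    qed (simp add: R_def inf_concat_ge_1)
  qed
  moreover have Q: "Q \<gamma> t = (if \<gamma> n then c n t else x)" if "t \<in> {0..1}" for \<gamma> t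
  proof -
    let ?s = "\<phi> (node n) (node (Suc n)) t"
    obtain d where d: "d = node (Suc n) - node n" "0 < d" using node_less_iff[of n "Suc n"] by simp
    have eq: "?s = node n + t * d" by (simp add: \<phi>_def d(1))
    have "t * d \<le> 1 * d" using that d(2) by (intro mult_right_mono) auto
    moreover have "0 \<le> t * d" using that d(2) by simp
    ultimately have "node n \<le> ?s" "?s \<le> node (Suc n)" using eq d(1) by linarith+
    moreover have "(?s - node n) / (node (Suc n) - node n) = t"
      unfolding eq d(1)[symmetric] using d(2) by simp
    ultimately show ?thesis by (simp add: Q_def L_block)
  qed
  then have "?cls (Q \<alpha>) = ?cls (c n)" "?cls (Q \<beta>) = ?cls (\<lambda>_. x)"
    using assms(1,2) by (auto intro!: eqI PQR)
  ultimately have "?cls (L \<alpha>) = ?cls (P \<alpha>) \<otimes>\<^bsub>G\<^esub> (?cls (c n) \<otimes>\<^bsub>G\<^esub> ?cls (R \<alpha>))"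
    "?cls (L \<beta>) = ?cls (P \<alpha>) \<otimes>\<^bsub>G\<^esub> ?cls (R \<alpha>)"
    using split[of \<alpha>] split[of \<beta>] PQR by (simp_all add: G_def one_fundamental_group[symmetric]
       group.is_monoid group_fundamental_group base_in)
  moreover have "p \<otimes>\<^bsub>G\<^esub> (q \<otimes>\<^bsub>G\<^esub> r) \<otimes>\<^bsub>G\<^esub> inv\<^bsub>G\<^esub> (p \<otimes>\<^bsub>G\<^esub> r) = p \<otimes>\<^bsub>G\<^esub> q \<otimes>\<^bsub>G\<^esub> inv\<^bsub>G\<^esub> p"
    if "p \<in> carrier G" "q \<in> carrier G" "r \<in> carrier G" for p q r
  proof -
    have "r \<otimes>\<^bsub>G\<^esub> (inv\<^bsub>G\<^esub> r \<otimes>\<^bsub>G\<^esub> inv\<^bsub>G\<^esub> p) = inv\<^bsub>G\<^esub> p"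
      using that by (simp flip: m_assoc)
    then show ?thesis using that by (simp add: m_assoc inv_mult_group)
  qed
  ultimately have "?cls (L \<alpha>) \<otimes>\<^bsub>G\<^esub> inv\<^bsub>G\<^esub> ?cls (L \<beta>) = ?cls (P \<alpha>) \<otimes>\<^bsub>G\<^esub> ?cls (c n) \<otimes>\<^bsub>G\<^esub> inv\<^bsub>G\<^esub> ?cls (P \<alpha>)"
    using PQR loops by (simp add: G_def)
  then show ?thesis
    using PQR(1) unfolding G_def by (intro bexI[of _ "?cls (P \<alpha>)"]) auto
qed

end

section \<open>Commutator lengths and Suslin's operation\<close>

text \<open>Bracketed like \<open>group_commutator\<close>, so its class is found without
  reassociating paths.\<close>

definition commutator_path :: "(real \<Rightarrow> 'a::topological_space) \<Rightarrow> (real \<Rightarrow> 'a) \<Rightarrow> real \<Rightarrow> 'a" where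
  "commutator_path a b = ((a +++ b) +++ reversepath a) +++ reversepath b"

definition commutators_path :: "'a::topological_space \<Rightarrow> ((real \<Rightarrow> 'a) \<times> (real \<Rightarrow> 'a)) list \<Rightarrow> real \<Rightarrow> 'a" where
  "commutators_path x ps = foldr (\<lambda>(a, b) q. commutator_path a b +++ q) ps (\<lambda>_. x)"

lemma commutators_path_simps [simp]:
  "commutators_path x [] = (\<lambda>_. x)"
  "commutators_path x ((a, b) # ps) = commutator_path a b +++ commutators_path x ps"
  by (simp_all add: commutators_path_def)

lemma commutator_path_in_loops_at [simp]:
  "a \<in> loops_at S x \<Longrightarrow> b \<in> loops_at S x \<Longrightarrow> commutator_path a b \<in> loops_at S x"
  by (simp add: commutator_path_def)

lemma loop_class_commutator_path:
  "a \<in> loops_at S x \<Longrightarrow> b \<in> loops_at S x \<Longrightarrow> loop_class S x (commutator_path a b) =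
    group_commutator (fundamental_group S x) (loop_class S x a) (loop_class S x b)"
  by (simp add: commutator_path_def group_commutator_def inv_fundamental_group mult_fundamental_group)

lemma loop_class_commutators_path:
  assumes "x \<in> S" "set ps \<subseteq> loops_at S x \<times> loops_at S x"
  shows "commutators_path x ps \<in> loops_at S x \<and> loop_class S x (commutators_path x ps) =
    prod_commutators (fundamental_group S x) (map (map_prod (loop_class S x) (loop_class S x)) ps)"
proof -
  interpret group "fundamental_group S x" by (rule group_fundamental_group) fact
  show ?thesis
    using assms(2)
  proof (induction ps)
    case Nil
    then show ?case using assms(1) by (simp add: prod_commutators_Nil one_fundamental_group)
  next
    case (Cons p ps)
    then show ?case
      by (cases p) (auto simp: prod_commutators_Cons loop_class_commutator_path mult_fundamental_group[symmetric])
  qed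
qed

text \<open>At a fixed \<open>s\<close> a concatenation reads one of the two paths at one fixed
  parameter. Hence the product of commutators varies continuously with its factors already for
  pointwise convergence.\<close>

lemma continuous_on_joinpaths_parameter:
  assumes "\<And>s. continuous_on T (\<lambda>y. p y s)" "\<And>s. continuous_on T (\<lambda>y. q y s)"
  shows "continuous_on T (\<lambda>y. (p y +++ q y) s)"
  using assms by (cases "s \<le> 1/2") (simp_all add: joinpaths_def)

lemma continuous_on_commutators_path_parameter:
  assumes "\<And>j s. continuous_on T (\<lambda>y. a j y s)" "\<And>j s. continuous_on T (\<lambda>y. b j y s)"
  shows "continuous_on T (\<lambda>y. commutators_path x (map (\<lambda>j. (a j y, b j y)) js) s)"
proof (induction js arbitrary: s)
  case (Cons j js)
  have rev: "continuous_on T (\<lambda>y. reversepath (a j y) s)" "continuous_on T (\<lambda>y. reversepath (b j y) s)" for s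
    using assms by (simp_all add: reversepath_def)
  show ?case
    unfolding list.map commutators_path_simps commutator_path_def
    by (rule continuous_on_joinpaths_parameter assms Cons.IH rev)+
qed simp

text \<open>The compactness argument concerns total functions with all values in \<open>X\<close>.
  Clamping the parameter to the unit interval produces such a function without changing the path on
  that interval.\<close>

lemma loop_class_total_representative:
  assumes "A \<in> carrier (fundamental_group S x)"
  shows "\<exists>a\<in>loops_at S x. A = loop_class S x a \<and> range a \<subseteq> S"
proof -
  obtain p where p: "p \<in> loops_at S x" "A = loop_class S x p"
    using assms by (auto simp: carrier_fundamental_group)
  define a where "a t = p (max 0 (min 1 t))" for t
  have p': "path p" "path_image p \<subseteq> S" using p(1) by (auto simp: loops_at_def)
  have "homotopic_paths S p a"
    using p' by (intro homotopic_paths_eq) (auto simp: a_def)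
  moreover have "range a \<subseteq> S"
    using p'(2) by (auto simp: a_def path_image_def)
  ultimately show ?thesis
    using p homotopic_paths_loops_at loop_class_eqI by metis
qed

lemma is_prod_of_commutators_iff_homotopic:
  assumes l: "l \<in> loops_at S x"
  shows "is_prod_of_commutators (fundamental_group S x) k (loop_class S x l) \<longleftrightarrow>
    (\<exists>a b :: nat \<Rightarrow> real \<Rightarrow> 'a::topological_space.
      (\<forall>j. a j \<in> loops_at S x \<and> range (a j) \<subseteq> S \<and> b j \<in> loops_at S x \<and> range (b j) \<subseteq> S) \<and>
      homotopic_paths S l (commutators_path x (map (\<lambda>j. (a j, b j)) [0..<k])))"
    (is "_ \<longleftrightarrow> ?R")
proof
  have x: "x \<in> S" using l by (auto simp: loops_at_def)
  assume "is_prod_of_commutators (fundamental_group S x) k (loop_class S x l)"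
  then obtain xs where xs: "length xs = k"
    "set xs \<subseteq> carrier (fundamental_group S x) \<times> carrier (fundamental_group S x)"
    "loop_class S x l = prod_commutators (fundamental_group S x) xs"
    by (auto simp: is_prod_of_commutators_def)
  have "\<exists>a\<in>loops_at S x. (j < k \<longrightarrow> fst (xs ! j) = loop_class S x a) \<and> range a \<subseteq> S" for j
  proof (cases "j < k")
    case True
    then have "xs ! j \<in> carrier (fundamental_group S x) \<times> carrier (fundamental_group S x)"
      using xs(1,2) nth_mem by blast
    then have "fst (xs ! j) \<in> carrier (fundamental_group S x)"
      by (simp add: mem_Times_iff)
    from loop_class_total_representative[OF this] show ?thesis by blast
  next
    case False
    \<comment> \<open>Past the \<open>k\<close> pairs the sequence is filled up with constant loops,
      so that its type does not depend on \<open>k\<close>.\<close>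
    then show ?thesis using x by (intro bexI[of _ "\<lambda>_. x"]) auto
  qed
  then obtain a where a: "\<And>j. a j \<in> loops_at S x" "\<And>j. range (a j) \<subseteq> S"
    "\<And>j. j < k \<Longrightarrow> fst (xs ! j) = loop_class S x (a j)"
    by metis
  have "\<exists>a\<in>loops_at S x. (j < k \<longrightarrow> snd (xs ! j) = loop_class S x a) \<and> range a \<subseteq> S" for j
  proof (cases "j < k")
    case True
    then have "xs ! j \<in> carrier (fundamental_group S x) \<times> carrier (fundamental_group S x)"
      using xs(1,2) nth_mem by blast
    then have "snd (xs ! j) \<in> carrier (fundamental_group S x)"
      by (simp add: mem_Times_iff)
    from loop_class_total_representative[OF this] show ?thesis by blast
  next
    case False
    then show ?thesis using x by (intro bexI[of _ "\<lambda>_. x"]) auto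
  qed
  then obtain b where b: "\<And>j. b j \<in> loops_at S x" "\<And>j. range (b j) \<subseteq> S"
    "\<And>j. j < k \<Longrightarrow> snd (xs ! j) = loop_class S x (b j)"
    by metis
  let ?ps = "map (\<lambda>j. (a j, b j)) [0..<k]"
  have "map (map_prod (loop_class S x) (loop_class S x)) ?ps = xs"
    using xs(1) a(3) b(3) by (intro nth_equalityI) (auto simp: prod_eq_iff)
  moreover have "set ?ps \<subseteq> loops_at S x \<times> loops_at S x"
    using a(1) b(1) by auto
  ultimately have "loop_class S x l = loop_class S x (commutators_path x ?ps)"
    using loop_class_commutators_path[OF x] xs(3) by metis
  then show ?R
    using a b l by (intro exI[of _ a] exI[of _ b]) (auto simp: loop_class_eq_iff)
next
  have x: "x \<in> S" using l by (auto simp: loops_at_def)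
  assume ?R
  then obtain a b :: "nat \<Rightarrow> real \<Rightarrow> 'a" where ab: "\<And>j. a j \<in> loops_at S x" "\<And>j. b j \<in> loops_at S x"
    and hom: "homotopic_paths S l (commutators_path x (map (\<lambda>j. (a j, b j)) [0..<k]))"
    by blast
  let ?ps = "map (\<lambda>j. (a j, b j)) [0..<k]"
  have ps: "set ?ps \<subseteq> loops_at S x \<times> loops_at S x" using ab by auto
  have "loop_class S x l =
      prod_commutators (fundamental_group S x) (map (map_prod (loop_class S x) (loop_class S x)) ?ps)"
    using loop_class_eqI[OF l hom] loop_class_commutators_path[OF x ps] by simp
  moreover have "set (map (map_prod (loop_class S x) (loop_class S x)) ?ps)
      \<subseteq> carrier (fundamental_group S x) \<times> carrier (fundamental_group S x)"
    using ab by auto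
  ultimately show "is_prod_of_commutators (fundamental_group S x) k (loop_class S x l)"
    unfolding is_prod_of_commutators_def
    by (intro exI[of _ "map (map_prod (loop_class S x) (loop_class S x)) ?ps"] conjI) simp_all
qed

text \<open>Every clause equates values at points and is thus closed for pointwise convergence;
  continuity is left to the moduli in \<open>continuous_witness_Suslin\<close>. Odd indices carry
  the left entries of the commutators and positive even ones the right entries. The loops are spread
  over the square too, so that all witnesses share one compact domain.\<close>

definition encodes_commutator_homotopy ::
  "'a::topological_space \<Rightarrow> nat \<Rightarrow> (real \<Rightarrow> 'a) \<Rightarrow> (nat \<Rightarrow> real \<times> real \<Rightarrow> 'a) \<Rightarrow> bool" where
  "encodes_commutator_homotopy x k l w \<longleftrightarrow>
    (\<forall>s\<in>{0..1}. w 0 (0, s) = l s \<and> w 0 (s, 0) = x \<and> w 0 (s, 1) = x \<and>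
       w 0 (1, s) = commutators_path x
         (map (\<lambda>j. (\<lambda>t. w (Suc (2 * j)) (t, 0), \<lambda>t. w (Suc (2 * j + 1)) (t, 0))) [0..<k]) s) \<and>
    (\<forall>i. w (Suc i) (0, 0) = x \<and> w (Suc i) (1, 0) = x)"

text \<open>The map \<open>w 0\<close> encodes a homotopy from \<open>l\<close> to a product of \<open>k\<close> commutators of the loops that the
  maps \<open>w (Suc i)\<close> encode along the bottom edge of the square.\<close>

lemma is_prod_of_commutators_iff_witness:
  assumes l: "l \<in> loops_at S x"
  shows "is_prod_of_commutators (fundamental_group S x) k (loop_class S x l) \<longleftrightarrow>
    (\<exists>w :: nat \<Rightarrow> real \<times> real \<Rightarrow> 'a::topological_space. (\<forall>i z. w i z \<in> S) \<and>
      (\<forall>i. continuous_on ({0..1} \<times> {0..1}) (w i)) \<and> encodes_commutator_homotopy x k l w)"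
    (is "_ \<longleftrightarrow> ?R")
  unfolding is_prod_of_commutators_iff_homotopic[OF l]
proof
  let ?Q = "{0..1::real} \<times> {0..1::real}"
  have x: "x \<in> S" using l by (auto simp: loops_at_def)
  assume "\<exists>a b :: nat \<Rightarrow> real \<Rightarrow> 'a.
      (\<forall>j. a j \<in> loops_at S x \<and> range (a j) \<subseteq> S \<and> b j \<in> loops_at S x \<and> range (b j) \<subseteq> S) \<and>
      homotopic_paths S l (commutators_path x (map (\<lambda>j. (a j, b j)) [0..<k]))"
  then obtain a b :: "nat \<Rightarrow> real \<Rightarrow> 'a" where
    ab: "\<And>j. a j \<in> loops_at S x" "\<And>j. b j \<in> loops_at S x" "\<And>j t. a j t \<in> S" "\<And>j t. b j t \<in> S"
    and hom: "homotopic_paths S l (commutators_path x (map (\<lambda>j. (a j, b j)) [0..<k]))"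
    by blast
  obtain h where h: "continuous_on ?Q h" "h \<in> ?Q \<rightarrow> S" "\<And>s. s \<in> {0..1} \<Longrightarrow> h (0, s) = l s"
    "\<And>s. s \<in> {0..1} \<Longrightarrow> h (1, s) = commutators_path x (map (\<lambda>j. (a j, b j)) [0..<k]) s"
    "\<And>t. t \<in> {0..1} \<Longrightarrow> pathstart (h \<circ> Pair t) = pathstart l \<and> pathfinish (h \<circ> Pair t) = pathfinish l"
    using hom unfolding homotopic_paths by blast
  define c where "c i = (if even i then a (i div 2) else b (i div 2))" for i
  \<comment> \<open>The value \<open>x\<close> outside the square keeps all values in
    \<open>S\<close>.\<close>
  define w where "w i z = (case i of 0 \<Rightarrow> if z \<in> ?Q then h z else x | Suc i \<Rightarrow> c i (fst z))" for i z
  have c: "c i \<in> loops_at S x" "c i t \<in> S" for i t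
    using ab by (simp_all add: c_def)
  have "w i z \<in> S" for i z
    using c(2) h(2) x by (auto simp: w_def split: nat.split)
  moreover have "continuous_on ?Q (w i)" for i
  proof (cases i)
    case 0
    then show ?thesis by (intro continuous_on_eq[OF h(1)]) (simp add: w_def)
  next
    case (Suc i)
    have "continuous_on ?Q (\<lambda>z. c i (fst z))"
    proof (rule continuous_on_compose2[of "{0..1}" "c i"])
      show "continuous_on {0..1} (c i)" using c(1)[of i] by (simp add: loops_at_def path_def)
    qed (auto intro: continuous_intros)
    then show ?thesis using Suc by (simp add: w_def)
  qed
  moreover have "encodes_commutator_homotopy x k l w"
  proof -
    have "(\<lambda>j. (\<lambda>t. w (Suc (2 * j)) (t, 0), \<lambda>t. w (Suc (2 * j + 1)) (t, 0))) = (\<lambda>j. (a j, b j))"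
      by (auto simp: w_def c_def)
    moreover have "w 0 (s, 0) = x" "w 0 (s, 1) = x" if "s \<in> {0..1}" for s
      using h(5)[OF that] that l by (auto simp: w_def loops_at_def pathstart_def pathfinish_def)
    moreover have "c i 0 = x" "c i 1 = x" for i
      using c(1)[of i] by (auto simp: loops_at_def pathstart_def pathfinish_def)
    ultimately show ?thesis
      using h(3,4) unfolding encodes_commutator_homotopy_def by (simp add: w_def)
  qed
  ultimately show ?R by blast
next
  let ?Q = "{0..1::real} \<times> {0..1::real}"
  assume ?R
  then obtain w :: "nat \<Rightarrow> real \<times> real \<Rightarrow> 'a" where w: "\<And>i z. w i z \<in> S"
    "\<And>i. continuous_on ?Q (w i)" "encodes_commutator_homotopy x k l w"
    by blast
  define c where "c i = (\<lambda>t. w (Suc i) (t, 0))" for i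
  have c: "c i \<in> loops_at S x" "range (c i) \<subseteq> S" for i
  proof -
    have "continuous_on {0..1} (c i)"
      unfolding c_def
      by (rule continuous_on_compose2[OF w(2)[of "Suc i"]]) (auto intro!: continuous_intros)
    then show "c i \<in> loops_at S x" "range (c i) \<subseteq> S"
      using w(1,3) by (auto simp: c_def loops_at_def path_def path_image_def pathstart_def pathfinish_def
          encodes_commutator_homotopy_def)
  qed
  have "homotopic_paths S l (commutators_path x (map (\<lambda>j. (c (2 * j), c (2 * j + 1))) [0..<k]))"
    unfolding homotopic_paths
  proof (intro exI[of _ "w 0"] conjI)
    show "\<forall>s\<in>{0..1}. w 0 (1, s) = commutators_path x (map (\<lambda>j. (c (2 * j), c (2 * j + 1))) [0..<k]) s"
      using w(3) unfolding encodes_commutator_homotopy_def c_def by blast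
    show "\<forall>t\<in>{0..1}. pathstart (w 0 \<circ> Pair t) = pathstart l \<and> pathfinish (w 0 \<circ> Pair t) = pathfinish l"
      using w(3) l by (auto simp: encodes_commutator_homotopy_def loops_at_def pathstart_def pathfinish_def)
  qed (use w in \<open>auto simp: encodes_commutator_homotopy_def\<close>)
  then show "\<exists>a b :: nat \<Rightarrow> real \<Rightarrow> 'a.
      (\<forall>j. a j \<in> loops_at S x \<and> range (a j) \<subseteq> S \<and> b j \<in> loops_at S x \<and> range (b j) \<subseteq> S) \<and>
      homotopic_paths S l (commutators_path x (map (\<lambda>j. (a j, b j)) [0..<k]))"
    using c by (intro exI[of _ "\<lambda>j. c (2 * j)"] exI[of _ "\<lambda>j. c (2 * j + 1)"]) auto
qed

lemma closed_encodes_commutator_homotopy: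
  fixes l :: "'z::topological_space \<Rightarrow> real \<Rightarrow> 'a::metric_space"
  assumes l: "\<And>s. continuous_on UNIV (\<lambda>z. l z s)"
  shows "closed {(z, w). encodes_commutator_homotopy x k (l z) w}"
proof -
  have ev: "continuous_on UNIV (\<lambda>y :: 'z \<times> (nat \<Rightarrow> real \<times> real \<Rightarrow> 'a). snd y i z)" for i z
  proof -
    have "continuous_on UNIV (\<lambda>w :: nat \<Rightarrow> real \<times> real \<Rightarrow> 'a. w i z)"
      by (rule continuous_on_product_then_coordinatewise[OF continuous_on_product_coordinates])
    from continuous_on_compose2[OF this continuous_on_snd[OF continuous_on_id]] show ?thesis by simp
  qed
  have l': "continuous_on UNIV (\<lambda>y :: 'z \<times> (nat \<Rightarrow> real \<times> real \<Rightarrow> 'a). l (fst y) s)" for s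
    using continuous_on_compose2[OF l continuous_on_fst[OF continuous_on_id]] by simp
  let ?c = "\<lambda>(y :: 'z \<times> (nat \<Rightarrow> real \<times> real \<Rightarrow> 'a)) s. commutators_path x
    (map (\<lambda>j. (\<lambda>t. snd y (Suc (2 * j)) (t, 0), \<lambda>t. snd y (Suc (2 * j + 1)) (t, 0))) [0..<k]) s"
  have "{(z, w). encodes_commutator_homotopy x k (l z) w} =
    (\<Inter>s\<in>{0..1}. {y. snd y 0 (0, s) = l (fst y) s} \<inter> {y. snd y 0 (s, 0) = x} \<inter> {y. snd y 0 (s, 1) = x} \<inter>
       {y. snd y 0 (1, s) = ?c y s}) \<inter>
    (\<Inter>i. {y. snd y (Suc i) (0, 0) = x} \<inter> {y. snd y (Suc i) (1, 0) = x})"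
    unfolding encodes_commutator_homotopy_def by auto
  also have "closed \<dots>"
    by (intro closed_Int closed_INT ballI closed_Collect_eq ev l' continuous_on_const
        continuous_on_commutators_path_parameter)
  finally show ?thesis .
qed

section \<open>Small loops have bounded commutator length\<close>

text \<open>A real number is determined by the rationals below it.\<close>

lemma real_lepoll_Cantor: "(UNIV :: real set) \<lesssim> (UNIV :: (nat \<Rightarrow> bool) set)"
proof -
  define f :: "real \<Rightarrow> nat \<Rightarrow> bool" where "f x n \<longleftrightarrow> of_rat (from_nat n) < x" for x n
  have "f x \<noteq> f y" if less: "x < y" for x y
  proof -
    obtain q where q: "x < of_rat q" "of_rat q < y"
      using of_rat_dense[OF less] by blast
    have "f y (to_nat q)" "\<not> f x (to_nat q)"
      using q by (simp_all add: f_def)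
    then show ?thesis by metis
  qed
  then have "inj f" by (metis injI linorder_neqE)
  then show ?thesis unfolding lepoll_def by blast
qed

context null_sequence_of_loops
begin

abbreviation \<pi>\<^sub>1 where "\<pi>\<^sub>1 \<equiv> fundamental_group X x"

lemma group_\<pi>\<^sub>1: "group \<pi>\<^sub>1"
  using base_in by (rule group_fundamental_group)

definition L_diff :: "(nat \<Rightarrow> bool) \<Rightarrow> (nat \<Rightarrow> bool) \<Rightarrow> (real \<Rightarrow> 'a) set" where
  "L_diff \<alpha> \<beta> = loop_class X x (L \<alpha>) \<otimes>\<^bsub>\<pi>\<^sub>1\<^esub> inv\<^bsub>\<pi>\<^sub>1\<^esub> loop_class X x (L \<beta>)"

text \<open>The \<open>E k\<close> of the overview, with exactly \<open>k\<close> commutators. The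
  loops \<open>c n\<close> are chosen against every number of commutators up to \<open>n\<close>, so
  an exact count does as well as a bound.\<close>

definition close_pairs :: "nat \<Rightarrow> ((nat \<Rightarrow> bool) \<times> (nat \<Rightarrow> bool)) set" where
  "close_pairs k = {(\<alpha>, \<beta>). is_prod_of_commutators \<pi>\<^sub>1 k (L_diff \<alpha> \<beta>)}"

lemma L_diff_inv: "inv\<^bsub>\<pi>\<^sub>1\<^esub> L_diff \<alpha> \<beta> = L_diff \<beta> \<alpha>"
proof -
  interpret group \<pi>\<^sub>1 by (rule group_\<pi>\<^sub>1)
  show ?thesis using L_loop by (simp add: L_diff_def inv_mult_group)
qed

lemma L_diff_mult: "L_diff \<alpha> \<beta> \<otimes>\<^bsub>\<pi>\<^sub>1\<^esub> L_diff \<beta> \<gamma> = L_diff \<alpha> \<gamma>"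
proof -
  interpret group \<pi>\<^sub>1 by (rule group_\<pi>\<^sub>1)
  let ?c = "\<lambda>\<alpha>. loop_class X x (L \<alpha>)"
  have c: "?c \<alpha> \<in> carrier \<pi>\<^sub>1" for \<alpha> using L_loop by simp
  have "inv\<^bsub>\<pi>\<^sub>1\<^esub> ?c \<beta> \<otimes>\<^bsub>\<pi>\<^sub>1\<^esub> (?c \<beta> \<otimes>\<^bsub>\<pi>\<^sub>1\<^esub> inv\<^bsub>\<pi>\<^sub>1\<^esub> ?c \<gamma>) = inv\<^bsub>\<pi>\<^sub>1\<^esub> ?c \<gamma>"
    using c by (simp flip: m_assoc)
  then show ?thesis using c by (simp add: L_diff_def m_assoc)
qed

lemma close_pairs_sym: "(\<alpha>, \<beta>) \<in> close_pairs k \<Longrightarrow> (\<beta>, \<alpha>) \<in> close_pairs k"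
  using group.is_prod_of_commutators_inv[OF group_\<pi>\<^sub>1] L_diff_inv
  unfolding close_pairs_def by (metis (mono_tags, lifting) case_prodD case_prodI mem_Collect_eq)

lemma close_pairs_trans:
  "(\<alpha>, \<beta>) \<in> close_pairs k \<Longrightarrow> (\<beta>, \<gamma>) \<in> close_pairs m \<Longrightarrow> (\<alpha>, \<gamma>) \<in> close_pairs (k + m)"
  using group.is_prod_of_commutators_mult[OF group_\<pi>\<^sub>1] L_diff_mult
  unfolding close_pairs_def by fastforce

text \<open>By \<open>loop_class_L_flip\<close> the quotient is a conjugate of \<open>c n\<close> if
  \<beta> \<open>n\<close> holds; otherwise the pair is swapped, which inverts the quotient.\<close>

lemma close_pairs_flip:
  assumes "(\<beta>, \<beta>(n := \<not> \<beta> n)) \<in> close_pairs k"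
  shows "is_prod_of_commutators \<pi>\<^sub>1 k (loop_class X x (c n))"
proof -
  have c: "loop_class X x (c n) \<in> carrier \<pi>\<^sub>1" using loops by simp
  have *: "is_prod_of_commutators \<pi>\<^sub>1 k (loop_class X x (c n))"
    if close: "(\<alpha>, \<beta>) \<in> close_pairs k" and flip: "\<alpha> n" "\<not> \<beta> n" "\<And>i. i \<noteq> n \<Longrightarrow> \<alpha> i = \<beta> i" for \<alpha> \<beta>
  proof -
    obtain p where p: "p \<in> carrier \<pi>\<^sub>1"
      "L_diff \<alpha> \<beta> = p \<otimes>\<^bsub>\<pi>\<^sub>1\<^esub> loop_class X x (c n) \<otimes>\<^bsub>\<pi>\<^sub>1\<^esub> inv\<^bsub>\<pi>\<^sub>1\<^esub> p"
      using loop_class_L_flip[of \<alpha> n \<beta>, OF flip] unfolding L_diff_def by blast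
    show ?thesis
      using group.is_prod_of_commutators_conj[OF group_\<pi>\<^sub>1 p(1) c] close p(2)
      by (simp add: close_pairs_def)
  qed
  show ?thesis
  proof (cases "\<beta> n")
    case True
    then show ?thesis using *[OF assms] by simp
  next
    case False
    then show ?thesis using *[OF close_pairs_sym[OF assms]] by simp
  qed
qed

lemma close_pairs_Suslin:
  assumes "compact X"
  shows "\<exists>F. (\<forall>s::nat list. closed (F s)) \<and>
    close_pairs k = {z. \<exists>m. \<forall>n. z \<in> F (map m [0..<n])}"
proof -
  define l where "l z = L (fst z) +++ reversepath (L (snd z))" for z :: "(nat \<Rightarrow> bool) \<times> (nat \<Rightarrow> bool)"
  have loop: "l z \<in> loops_at X x" for z
    using L_loop by (simp add: l_def)
  have "continuous_on UNIV (\<lambda>z. L (fst z) s)" "continuous_on UNIV (\<lambda>z. L (snd z) s)"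
    for s and z :: "(nat \<Rightarrow> bool) \<times> (nat \<Rightarrow> bool)"
    using continuous_on_compose2[OF continuous_on_L_index continuous_on_fst[OF continuous_on_id], of UNIV s]
      continuous_on_compose2[OF continuous_on_L_index continuous_on_snd[OF continuous_on_id], of UNIV s]
    by auto
  then have "continuous_on UNIV (\<lambda>z. l z s)" for s
    unfolding l_def reversepath_def by (intro continuous_on_joinpaths_parameter)
  then have closed: "closed {(z, w). encodes_commutator_homotopy x k (l z) w}"
    by (rule closed_encodes_commutator_homotopy)
  have "z \<in> close_pairs k \<longleftrightarrow> (\<exists>w. (\<forall>i y. w i y \<in> X) \<and> (\<forall>i. continuous_on ({0..1} \<times> {0..1}) (w i)) \<and>
      encodes_commutator_homotopy x k (l z) w)" for z
  proof -
    have "L_diff (fst z) (snd z) = loop_class X x (l z)"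
      using L_loop by (simp add: L_diff_def l_def inv_fundamental_group mult_fundamental_group)
    then show ?thesis
      using is_prod_of_commutators_iff_witness[OF loop[of z]] by (simp add: close_pairs_def case_prod_beta)
  qed
  then have "close_pairs k = {z. \<exists>w. (\<forall>i y. w i y \<in> X) \<and> (\<forall>i. continuous_on ({0..1} \<times> {0..1}) (w i)) \<and>
      (z, w) \<in> {(z, w). encodes_commutator_homotopy x k (l z) w}}"
    by auto
  moreover have "compact ({0..1::real} \<times> {0..1::real})"
    by (intro compact_Times compact_Icc)
  ultimately show ?thesis
    using continuous_witness_Suslin[OF compact_Cantor_pairs Hausdorff_Cantor_pairs closed assms]
    by (simp only:)
qed

lemma nonmeager_close_pairs:
  assumes "compact X" "\<not> meager (close_pairs k)"
  shows "\<exists>n\<ge>k + k. is_prod_of_commutators \<pi>\<^sub>1 (k + k) (loop_class X x (c n))"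
proof -
  let ?E = "close_pairs k"
  obtain F where F: "\<And>s::nat list. closed (F s)" "?E = {z. \<exists>m. \<forall>n. z \<in> F (map m [0..<n])}"
    using close_pairs_Suslin[OF assms(1), of k] by blast
  obtain U where U: "open U" "U \<noteq> {}" "meager (U - ?E)"
    using Suslin_nonmeager_imp_comeager[OF F assms(2)] .
  obtain \<alpha> \<beta> where "(\<alpha>, \<beta>) \<in> U" using U(2) by auto
  then obtain A B where AB: "open A" "open B" "\<alpha> \<in> A" "\<beta> \<in> B" "A \<times> B \<subseteq> U"
    using U(1) open_prod_elim[of U "(\<alpha>, \<beta>)"] by (metis mem_Sigma_iff)
  obtain m where m: "\<forall>n\<ge>m. \<forall>y. agree_on {..<n} y \<beta> \<longrightarrow> y \<in> B"
    using open_contains_cylinder[OF AB(2,4)] by blast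
  \<comment> \<open>Past \<open>m\<close> the flip of place \<open>n\<close> keeps the second
    coordinate inside \<open>B\<close>; past \<open>k + k\<close> the count obtained at the end
    contradicts the choice of \<open>c n\<close>.\<close>
  define n where "n = max m (k + k)"
  define V where "V = A \<times> {y. agree_on {..<n} y \<beta>}"
  define \<phi> where "\<phi> z = (fst z, (snd z)(n := \<not> snd z n))" for z :: "(nat \<Rightarrow> bool) \<times> (nat \<Rightarrow> bool)"
  have V: "open V" "(\<alpha>, \<beta>) \<in> V" "V \<subseteq> U"
  proof -
    show "open V" unfolding V_def by (intro open_Times AB(1) open_cylinder)
    show "(\<alpha>, \<beta>) \<in> V" using AB(3) by (simp add: V_def agree_on_def)
    have "m \<le> n" by (simp add: n_def)
    then show "V \<subseteq> U" using m AB(5) by (auto simp: V_def)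
  qed
  have \<phi>_\<phi>: "\<phi> (\<phi> z) = z" for z by (simp add: \<phi>_def)
  have \<phi>_V: "\<phi> z \<in> V" if "z \<in> V" for z
    using that by (simp add: \<phi>_def V_def agree_on_def mem_Times_iff)
  have "continuous_on UNIV \<phi>"
    unfolding \<phi>_def
  proof (intro continuous_on_Pair continuous_on_fst continuous_on_id continuous_on_coordinatewise_then_product)
    fix i
    have snd: "continuous_on UNIV (\<lambda>z :: (nat \<Rightarrow> bool) \<times> (nat \<Rightarrow> bool). snd z i)"
      using continuous_on_compose2[OF continuous_on_product_coordinates continuous_on_snd[OF continuous_on_id], of UNIV i]
      by simp
    have "continuous_on UNIV Not" by (auto simp: continuous_on_open_vimage open_discrete)
    from continuous_on_compose2[OF this snd] snd
    show "continuous_on UNIV (\<lambda>z :: (nat \<Rightarrow> bool) \<times> (nat \<Rightarrow> bool). ((snd z)(n := \<not> snd z n)) i)"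
      by (cases "i = n") auto
  qed
  then have "meager (\<phi> ` (U - ?E))"
    using U(3) \<phi>_\<phi> by (intro meager_homeomorphic_image)
  with U(3) have "meager ((U - ?E) \<union> \<phi> ` (U - ?E))"
    by (rule meager_Un)
  \<comment> \<open>Two meager sets are to be avoided in \<open>V\<close>: the points outside
    \<open>close_pairs k\<close> and those that \<phi> sends outside. By Baire's theorem they do not
    cover \<open>V\<close>.\<close>
  moreover have "\<not> meager V"
    using Baire_meager[OF compact_Cantor_pairs Hausdorff_Cantor_pairs V(1)] V(2) by blast
  ultimately obtain z where z: "z \<in> V" "z \<notin> U - ?E" "z \<notin> \<phi> ` (U - ?E)"
    using meager_subset by blast
  have "z \<in> ?E" using z V(3) by blast
  moreover have "\<phi> z \<in> ?E"
  proof (rule ccontr)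
    assume "\<phi> z \<notin> ?E"
    then have "\<phi> z \<in> U - ?E" using \<phi>_V[OF z(1)] V(3) by blast
    then show False using z(3) \<phi>_\<phi> by (metis imageI)
  qed
  \<comment> \<open>Both pairs share the first coordinate of \<open>z\<close>; passing through it
    adds the two counts.\<close>
  ultimately have "(snd z, (snd z)(n := \<not> snd z n)) \<in> close_pairs (k + k)"
    using close_pairs_trans[OF close_pairs_sym] by (metis \<phi>_def prod.collapse)
  then show ?thesis
    using close_pairs_flip n_def by (intro exI[of _ n]) auto
qed

lemma homologous_L_close_pairs:
  assumes "path_connected X"
    and "homologous_rel 1 (top_of_set X) {} (frag_of (simplex_of_path (L \<alpha>))) (frag_of (simplex_of_path (L \<beta>)))"
  shows "\<exists>k. (\<alpha>, \<beta>) \<in> close_pairs k"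
  using homologous_loops_derived[OF assms(1) L_loop L_loop assms(2)]
    group.derived_imp_is_prod_of_commutators[OF group_\<pi>\<^sub>1]
  by (auto simp: close_pairs_def L_diff_def)

text \<open>Homologous loops give a pair in \<open>close_pairs k\<close> for some \<open>k\<close>,
  so Mycielski's theorem is applied to the union over all \<open>k\<close>. The homology classes of
  the selected loops are then pairwise distinct.\<close>

lemma meager_close_pairs:
  assumes "path_connected X" "\<And>k. meager (close_pairs k)"
  shows "(UNIV :: real set) \<lesssim> carrier (homology_group 1 (top_of_set X))"
proof -
  have "meager (\<Union>k. close_pairs k)"
    using assms(2) by (rule meager_UN_nat)
  then obtain g :: "(nat \<Rightarrow> bool) \<Rightarrow> nat \<Rightarrow> bool" where
    g: "\<And>\<alpha> \<beta>. \<alpha> \<noteq> \<beta> \<Longrightarrow> (g \<alpha>, g \<beta>) \<notin> (\<Union>k. close_pairs k)"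
    using Mycielski[of "\<Union>k. close_pairs k"] close_pairs_sym by blast
  define h where "h \<alpha> = homologous_rel_set 1 (top_of_set X) {} (frag_of (simplex_of_path (L (g \<alpha>))))" for \<alpha>
  have "inj h"
  proof (rule injI, rule ccontr)
    fix \<alpha> \<beta> assume "h \<alpha> = h \<beta>" "\<alpha> \<noteq> \<beta>"
    then have "homologous_rel 1 (top_of_set X) {} (frag_of (simplex_of_path (L (g \<alpha>))))
        (frag_of (simplex_of_path (L (g \<beta>))))"
      unfolding h_def homologous_rel_set_eq by simp
    from homologous_L_close_pairs[OF assms(1) this] g[OF \<open>\<alpha> \<noteq> \<beta>\<close>] show False
      by blast
  qed
  moreover have "h \<alpha> \<in> carrier (homology_group 1 (top_of_set X))" for \<alpha>
    using carrier_relative_homology_group[of 1 "top_of_set X" "{}"] singular_relcycle_simplex_of_path[OF L_loop]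
    by (auto simp: h_def)
  ultimately have "(UNIV :: (nat \<Rightarrow> bool) set) \<lesssim> carrier (homology_group 1 (top_of_set X))"
    unfolding lepoll_def by blast
  then show ?thesis
    using real_lepoll_Cantor lepoll_trans by blast
qed

end

text \<open>The base points accumulate at some \<open>x\<close> by compactness, and local path
  connectedness joins \<open>x\<close> to the nearby ones without leaving a small ball. Taking
  \<open>j \<ge> n\<close> preserves the growth of the commutator lengths along the selected
  loops.\<close>

lemma small_loops_at_point:
  fixes X :: "'a::metric_space set"
  assumes X: "compact X" "locally path_connected X"
    and l: "\<And>n. path (l n)" "\<And>n. path_image (l n) \<subseteq> X" "\<And>n. pathfinish (l n) = pathstart (l n)"
      "\<And>n. diameter (path_image (l n)) < 1 / (real n + 1)"
  shows "\<exists>x\<in>X. \<forall>n. \<exists>j\<ge>n. \<exists>q. path_in X q \<and> pathstart q = x \<and> pathfinish q = pathstart (l j) \<and>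
    path_image (conj_path q (l j) q) \<subseteq> ball x (1 / (real n + 1))"
proof -
  have "pathstart (l n) \<in> X" for n
    using l(2) pathstart_in_path_image by blast
  then obtain x r where x: "x \<in> X" "strict_mono (r :: nat \<Rightarrow> nat)" "(\<lambda>n. pathstart (l (r n))) \<longlonglongrightarrow> x"
    using X(1) unfolding compact_def by (metis (no_types, lifting) comp_apply ext)
  have "\<exists>j\<ge>n. \<exists>q. path_in X q \<and> pathstart q = x \<and> pathfinish q = pathstart (l j) \<and>
    path_image (conj_path q (l j) q) \<subseteq> ball x (1 / (real n + 1))" for n
  proof -
    let ?e = "1 / (real n + 1)"
    have "openin (top_of_set X) (X \<inter> ball x ?e)" "x \<in> X \<inter> ball x ?e"
      using x(1) by (auto simp: openin_open_Int)
    then obtain U V where UV: "openin (top_of_set X) U" "path_connected V" "x \<in> U" "U \<subseteq> V" "V \<subseteq> X \<inter> ball x ?e"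
      using X(2) unfolding locally_def by meson
    then obtain d where d: "d > 0" "ball x d \<inter> X \<subseteq> U"
      unfolding openin_contains_ball by blast
    \<comment> \<open>Distance below \<open>d\<close> puts the base point into the path connected
      set \<open>V\<close>; half of the radius is kept for the diameter of the loop.\<close>
    have "\<forall>\<^sub>F i in sequentially. dist (pathstart (l (r i))) x < min d (?e / 2)"
      using x(3) d(1) by (intro tendstoD) auto
    moreover have "\<forall>\<^sub>F i::nat in sequentially. 1 / (real i + 1) < ?e / 2"
      by (rule order_tendstoD(2)[of _ 0]) (real_asymp, simp)
    moreover have "\<forall>\<^sub>F i in sequentially. n \<le> i"
      by (rule eventually_ge_at_top)
    ultimately have "\<forall>\<^sub>F i in sequentially. dist (pathstart (l (r i))) x < min d (?e / 2) \<and>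
        1 / (real i + 1) < ?e / 2 \<and> n \<le> i"
      by eventually_elim simp
    then obtain i where i: "dist (pathstart (l (r i))) x < min d (?e / 2)" "1 / (real i + 1) < ?e / 2" "n \<le> i"
      using eventually_happens trivial_limit_sequentially by blast
    define j where "j = r i"
    have "i \<le> j" using x(2) by (simp add: j_def seq_suble)
    then have "1 / (real j + 1) \<le> 1 / (real i + 1)" by (simp add: frac_le)
    then have diam: "diameter (path_image (l j)) < ?e / 2" using l(4)[of j] i(2) by linarith
    have "pathstart (l j) \<in> V"
    proof -
      have "pathstart (l j) \<in> ball x d" using i(1) by (simp add: j_def dist_commute)
      moreover have "pathstart (l j) \<in> X" using l(2)[of j] pathstart_in_path_image by blast
      ultimately show ?thesis using d(2) UV(4) by blast
    qed
    moreover have "x \<in> V" using UV by auto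
    ultimately obtain q where q: "path q" "path_image q \<subseteq> V" "pathstart q = x" "pathfinish q = pathstart (l j)"
      using UV(2) unfolding path_connected_def by blast
    have "y \<in> ball x ?e" if "y \<in> path_image (l j)" for y
    proof -
      have "dist (pathstart (l j)) y \<le> diameter (path_image (l j))"
        using that l(1) by (intro diameter_bounded_bound) (auto simp: bounded_path_image)
      moreover have "dist x (pathstart (l j)) < ?e / 2"
        using i(1) by (simp add: j_def dist_commute)
      ultimately show ?thesis
        using diam dist_triangle[of x y "pathstart (l j)"] by (simp only: mem_ball)
    qed
    moreover have "path_image (conj_path q (l j) q) \<subseteq> path_image q \<union> path_image (l j)"
      using q(4) l(3)[of j] by (simp add: conj_path_def path_image_join)
    ultimately have "path_image (conj_path q (l j) q) \<subseteq> ball x ?e"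
      using q(2) UV(5) by blast
    moreover have "path_in X q" using q UV(5) by (auto simp: path_in_def)
    moreover have "n \<le> j" using \<open>i \<le> j\<close> i(3) by simp
    ultimately show ?thesis
      using q(3,4) by (intro exI[of _ j] conjI exI[of _ q])
  qed
  with x(1) show ?thesis by blast
qed

theorem theorem3p2:
  fixes X :: "'a::metric_space set"
  assumes "compact X" and "path_connected X" and "locally path_connected X"
    and "carrier (homology_group 1 (top_of_set X)) \<prec> (UNIV :: real set)"
  shows "\<exists>\<epsilon>>0. \<exists>N::nat. \<forall>l. path l \<and> path_image l \<subseteq> X \<and> pathfinish l = pathstart l
           \<and> diameter (path_image l) < \<epsilon> \<longrightarrow>
           commutator_length (fundamental_group X (pathstart l)) (loop_class X (pathstart l) l) \<le> enat N"
proof (rule ccontr)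
  assume neg: "\<not> ?thesis"
  have "\<exists>l. path l \<and> path_image l \<subseteq> X \<and> pathfinish l = pathstart l \<and>
      diameter (path_image l) < 1 / (real n + 1) \<and>
      \<not> commutator_length (fundamental_group X (pathstart l)) (loop_class X (pathstart l) l) \<le> enat n" for n
  proof -
    have "0 < 1 / (real n + 1)" by simp
    with neg show ?thesis by blast
  qed
  then obtain l where l: "\<And>n. path (l n)" "\<And>n. path_image (l n) \<subseteq> X"
    "\<And>n. pathfinish (l n) = pathstart (l n)" "\<And>n. diameter (path_image (l n)) < 1 / (real n + 1)"
    and cl: "\<And>n. \<not> commutator_length (fundamental_group X (pathstart (l n)))
      (loop_class X (pathstart (l n)) (l n)) \<le> enat n"
    by metis
  obtain x where x: "x \<in> X" "\<And>n. \<exists>j\<ge>n. \<exists>q. path_in X q \<and> pathstart q = x \<and>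
      pathfinish q = pathstart (l j) \<and> path_image (conj_path q (l j) q) \<subseteq> ball x (1 / (real n + 1))"
    using small_loops_at_point[OF assms(1,3) l] by blast
  then obtain j q where jq: "\<And>n. n \<le> j n" "\<And>n. path_in X (q n)" "\<And>n. pathstart (q n) = x"
    "\<And>n. pathfinish (q n) = pathstart (l (j n))"
    "\<And>n. path_image (conj_path (q n) (l (j n)) (q n)) \<subseteq> ball x (1 / (real n + 1))"
    by metis
  define c where "c n = conj_path (q n) (l (j n)) (q n)" for n
  interpret null_sequence_of_loops X x c
  proof
    show "c n \<in> loops_at X x" for n
      using jq l by (simp add: c_def loops_at_iff path_in_def[of X "l (j n)"])
  qed (use jq(5) in \<open>simp add: c_def\<close>)
  \<comment> \<open>Moving the base point back to that of \<open>l (j n)\<close> preserves the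
    number of commutators, while the commutator length of \<open>l (j n)\<close> exceeds
    \<open>j n\<close>, which is at least \<open>n\<close>.\<close>
  have no_prod: "\<not> is_prod_of_commutators (fundamental_group X x) k (loop_class X x (c n))" if "k \<le> n" for k n
  proof
    assume "is_prod_of_commutators (fundamental_group X x) k (loop_class X x (c n))"
    then have "is_prod_of_commutators (fundamental_group X (pathfinish (q n))) k
        (loop_class X (pathfinish (q n)) (l (j n)))"
      using jq l by (intro is_prod_of_commutators_conj_path)
        (simp_all add: c_def loops_at_iff path_in_def[of X "l (j n)"])
    then have "commutator_length (fundamental_group X (pathstart (l (j n))))
        (loop_class X (pathstart (l (j n))) (l (j n))) \<le> enat k"
      unfolding jq(4) by (rule commutator_length_le)
    also have "enat k \<le> enat (j n)"
      using that jq(1)[of n] by simp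
    finally show False using cl by blast
  qed
  have "meager (close_pairs k)" for k
    using nonmeager_close_pairs[OF assms(1), of k] no_prod by blast
  then have "(UNIV :: real set) \<lesssim> carrier (homology_group 1 (top_of_set X))"
    by (rule meager_close_pairs[OF assms(2)])
  with assms(4) show False
    unfolding lesspoll_def using lepoll_antisym by blast
qed

end
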